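(* Let $M$ be a compact metric space, let $\Gamma<\mathrm{Homeo}(M)$ be a finitely generated subgroup, and let $\iota:\Gamma\to\mathrm{Homeo}(M)$ denote the inclusion homomorphism. Suppose that the $\Gamma$-action on $M$ is meandering hyperbolic. Then there is a neighborhood $\mathcal V$ of $\iota$ in $\mathrm{Hom}(\Gamma,\mathrm{Homeo}(M))$ (in the $C^0$ topology) such that every $\rho\in\mathcal V$ is semi-conjugate to $\iota$, i.e. for every $\rho\in\mathcal V$ there exists a continuous surjective map $\phi:M\to M$ with $\phi\circ\rho(g)=\iota(g)\circ\phi$ for every $g\in\Gamma$.
   Context: Notation. $\mathbb N=\{0,1,2,\dots\}$; $B(x,r)$ is the open ball of radius $r$ centered at $x$ in the metric space $(M,d)$; $f[A]$ is the image of $A$ under $f$. $\mathrm{Homeo}(M)$ is the group of homeomorphisms of $M$ with the $C^0$ topology, induced by the metric $d_\infty(f,g)=\sup_{x}d(f(x),g(x))+\sup_x d(f^{-1}(x),g^{-1}(x))$. $\mathrm{Hom}(\Gamma,\mathrm{Homeo}(M))$ carries the topology of pointwise convergence on a finite generating set of $\Gamma$ (this is "the $C^0$ topology" on actions). Expanding homeomorphisms and actions. For $\lambda>1$, $\delta>0$, $U\subset M$, a homeomorphism $f$ is $(\lambda,U;\delta)$-expanding if $B(f(x),\lambda r)\subset f[B(x,r)]$ whenever $B(x,r)\subset U$ and $0<r\le\delta$. It is expanding at $x$ if it is $(\lambda,U;\delta)$-expanding for some neighborhood $U$ of $x$, some $\lambda>1$ and some $\delta>0$. $\Gamma$ is expanding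 on $M$ if for every $x\in M$ there is $\gamma\in\Gamma$ such that $\gamma^{-1}$ is expanding at $x$. Expanding datum. An expanding datum for the $\Gamma$-action on $M$ is a tuple $\mathcal D=(I,\mathcal U,S,\lambda,\delta)$ such that for some $n$: $I=\{1,\dots,n\}$; $\mathcal U=\{U_1,\dots,U_n\}$ is an open cover of $M$ (some $U_i$ may be empty); $S=\{s_1,\dots,s_n\}\subset\Gamma$ is a symmetric generating set of $\Gamma$ ($S=S^{-1}$); $\lambda>1$, and $\delta>0$ is a Lebesgue number for $\mathcal U$ (every ball $B(x,\delta)$ is contained in some $U_i$); $s_i^{-1}$ is $(\lambda,U_i;\delta)$-expanding for all $i\in I$. Codes and rays. Let $0<\eta\le\delta$ and $x\in M$. A sequence $\alpha:\mathbb N\to I$ is a $(\mathcal D,\eta)$-code for $x$ if, with $x_0^\alpha=x$ and $x_{k+1}^\alpha=s_{\alpha(k)}^{-1}(x_k^\alpha)$ for $k\ge0$, one has $B(x_k^\alpha,\eta)\subset U_{\alpha(k)}$ for all $k\ge1$ (no condition at $k=0$). Its ray is $r^\alpha:\mathbb N\to\Gamma$, $r^\alpha_k=s_{\alpha(0)}s_{\alpha(1)}\cdots s_{\alpha(k)}$. $\mathrm{Ray}_x(\mathcal D,\eta)$ is the set of rays of all $(\mathcal D,\eta)$-codes for $x$. Refinement. An expanding datum $\mathcal D'=(I',\mathcal U',S',\lambda',\delta')$ for the same action is a refinement of $\mathcal D=(I,\mathcal U,S,\lambda,\delta)$, written $\mathcal D\prec\mathcal D'$, if $I\subset I'$; $U_i\subset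 U_i'$ and $s_i=s_i'$ for every $i\in I$; $0<\delta\le\delta'$; and $\lambda\ge\lambda'>1$. Then $\mathrm{Ray}_x(\mathcal D,\eta)\subset\mathrm{Ray}_x(\mathcal D',\eta)$ for all $x\in M$, $\eta\in(0,\delta]$. $L$-equivalence. For a finite generating set $S$, $d_S(g,h)=|g^{-1}h|_S$ is the word metric on $\Gamma$. Given an expanding datum $\mathcal D$ with generating set $S$, $0<\eta\le\delta$ and $L\ge0$, for $r^\alpha,r^\beta\in\mathrm{Ray}_x(\mathcal D,\eta)$ write $r^\alpha\approx_L r^\beta$ if there are infinite subsets $P,Q\subset\mathbb N$ such that $\{r^\alpha_k:k\in P\}$ and $\{r^\beta_j:j\in Q\}$ have Hausdorff distance at most $L$ in $(\Gamma,d_S)$. $L$-equivalence $\sim_L$ is the equivalence relation on $\mathrm{Ray}_x(\mathcal D,\eta)$ generated by $\approx_L$ (finite chains within $\mathrm{Ray}_x(\mathcal D,\eta)$). Meandering hyperbolicity. The $\Gamma$-action on $M$ is meandering hyperbolic if $\Gamma$ is expanding on $M$ with an expanding datum $\mathcal D$ for which there exist a refinement $\mathcal D'$ of $\mathcal D$ and a constant $L\ge0$ such that, for every $x\in M$ and every $\eta\in(0,\delta]$, all rays in $\mathrm{Ray}_x(\mathcal D,\eta)$ are $L$-equivalent when regarded as rays in $\mathrm{Ray}_x(\mathcal D',\eta)$ (i.e. with chains taken in $\mathrm{Ray}_x(\mathcal D',\eta)$ and with the word metric $d_{S'}$ of $\mathcal D'$). *)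

theory Defs
  imports "HOL-Analysis.Analysis" "HOL-Algebra.Generated_Groups"
begin

section \<open>Homeomorphism groups and their representation spaces\<close>

text \<open>The metric space is the whole type \<open>'a\<close>; compactness is assumed where it is needed.\<close>

definition homeo_group :: "('a::metric_space \<Rightarrow> 'a) monoid" where
  "homeo_group = \<lparr>carrier = {f. \<exists>g. homeomorphism UNIV UNIV f g}, mult = (\<circ>), one = id\<rparr>"

lemma in_homeo_group_iff:
  "f \<in> carrier homeo_group \<longleftrightarrow> bij f \<and> continuous_on UNIV f \<and> continuous_on UNIV (inv_into UNIV f)"
proof
  assume "f \<in> carrier homeo_group"
  then obtain g where g: "homeomorphism UNIV UNIV f g" by (auto simp: homeo_group_def)
  then have fg: "g (f x) = x" "f (g x) = x" for x by (auto simp: homeomorphism_def)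
  then have "bij f" by (metis bijI')
  moreover have "inv_into UNIV f = g" using fg by (metis inv_unique_comp comp_def ext id_apply)
  ultimately show "bij f \<and> continuous_on UNIV f \<and> continuous_on UNIV (inv_into UNIV f)"
    using g by (auto simp: homeomorphism_def)
next
  assume a: "bij f \<and> continuous_on UNIV f \<and> continuous_on UNIV (inv_into UNIV f)"
  then have "homeomorphism UNIV UNIV f (inv_into UNIV f)"
    by (auto simp: homeomorphism_def bij_is_surj bij_imp_bij_inv bij_is_inj surj_f_inv_f)
  then show "f \<in> carrier homeo_group" by (auto simp: homeo_group_def)
qed

lemma group_homeo_group: "group homeo_group"
proof (rule groupI)
  fix f g :: "'a \<Rightarrow> 'a"
  assume f: "f \<in> carrier homeo_group" and g: "g \<in> carrier homeo_group"
  have "bij (f \<circ> g)" using f g by (simp add: in_homeo_group_iff bij_comp)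
  moreover have "continuous_on UNIV (f \<circ> g)"
    using f g by (metis in_homeo_group_iff continuous_on_compose continuous_on_subset subset_UNIV)
  moreover have "inv_into UNIV (f \<circ> g) = inv_into UNIV g \<circ> inv_into UNIV f"
    using f g by (simp add: in_homeo_group_iff o_inv_distrib)
  moreover have "continuous_on UNIV (inv_into UNIV g \<circ> inv_into UNIV f)"
    using f g by (metis in_homeo_group_iff continuous_on_compose continuous_on_subset subset_UNIV)
  ultimately have "f \<circ> g \<in> carrier homeo_group" by (simp add: in_homeo_group_iff)
  then show "f \<otimes>\<^bsub>homeo_group\<^esub> g \<in> carrier homeo_group" by (simp add: homeo_group_def)
next
  show "\<one>\<^bsub>homeo_group\<^esub> \<in> carrier (homeo_group :: ('a \<Rightarrow> 'a) monoid)"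
    by (auto simp: homeo_group_def intro!: exI[of _ id] simp: homeomorphism_def)
next
  fix f :: "'a \<Rightarrow> 'a" assume f: "f \<in> carrier homeo_group"
  then have "inv_into UNIV f \<in> carrier homeo_group"
    by (simp add: in_homeo_group_iff bij_imp_bij_inv inv_inv_eq)
  moreover have "inv_into UNIV f \<circ> f = id"
    using f by (simp add: in_homeo_group_iff bij_is_inj)
  ultimately show "\<exists>g\<in>carrier homeo_group. g \<otimes>\<^bsub>homeo_group\<^esub> f = \<one>\<^bsub>homeo_group\<^esub>"
    by (auto simp: homeo_group_def)
qed (auto simp: homeo_group_def)

definition C0_dist :: "('a::metric_space \<Rightarrow> 'a) \<Rightarrow> ('a \<Rightarrow> 'a) \<Rightarrow> real" where
  "C0_dist f g = (SUP x. dist (f x) (g x)) + (SUP x. dist (inv_into UNIV f x) (inv_into UNIV g x))"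

lemma Metric_space_C0_dist:
  assumes "compact (UNIV :: 'a::metric_space set)"
  shows "Metric_space (carrier homeo_group) (C0_dist :: ('a \<Rightarrow> 'a) \<Rightarrow> _)"
proof -
  have bdd: "bdd_above (range (\<lambda>x. dist (f x) (g x)))" for f g :: "'a \<Rightarrow> 'a"
    using bounded_any_center[THEN iffD1, OF compact_imp_bounded[OF assms]]
      diameter_bounded_bound[OF compact_imp_bounded[OF assms]]
    by (auto intro!: bdd_aboveI2)
  have le: "dist (f x) (g x) \<le> (SUP x. dist (f x) (g x))" for f g :: "'a \<Rightarrow> 'a" and x
    by (rule cSUP_upper[OF UNIV_I bdd])
  have nn: "0 \<le> (SUP x. dist (f x) (g x))" for f g :: "'a \<Rightarrow> 'a"
    using le[of f undefined g] by (meson order_trans zero_le_dist)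
  have tri: "(SUP x. dist (f x) (h x)) \<le> (SUP x. dist (f x) (g x)) + (SUP x. dist (g x) (h x))"
    for f g h :: "'a \<Rightarrow> 'a"
  proof (rule cSUP_least)
    fix x show "dist (f x) (h x) \<le> (SUP x. dist (f x) (g x)) + (SUP x. dist (g x) (h x))"
      using le[of f x g] le[of g x h] dist_triangle[of "f x" "h x" "g x"] by linarith
  qed simp
  show ?thesis
  proof
    fix f g h :: "'a \<Rightarrow> 'a"
    show "0 \<le> C0_dist f g" unfolding C0_dist_def by (intro add_nonneg_nonneg nn)
    show "C0_dist f g = C0_dist g f" by (simp add: C0_dist_def dist_commute)
    show "C0_dist f g = 0 \<longleftrightarrow> f = g"
    proof
      assume "C0_dist f g = 0"
      then have "(SUP x. dist (f x) (g x)) = 0"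
        using nn[of f g] nn[of "inv_into UNIV f" "inv_into UNIV g"] by (simp add: C0_dist_def)
      then have "dist (f x) (g x) \<le> 0" for x using le[of f x g] by simp
      then show "f = g" by auto
    qed (simp add: C0_dist_def)
    show "C0_dist f h \<le> C0_dist f g + C0_dist g h"
      using tri[of f h g] tri[of "inv_into UNIV f" "inv_into UNIV h" "inv_into UNIV g"]
      by (simp add: C0_dist_def)
  qed
qed

definition homeo_topology :: "('a::metric_space \<Rightarrow> 'a) topology" where
  "homeo_topology = Metric_space.mtopology (carrier homeo_group) C0_dist"

text \<open>Homomorphisms are made extensional, so that each one is represented by a single function.\<close>

definition Hom_homeo :: "('a::metric_space \<Rightarrow> 'a) set \<Rightarrow> (('a \<Rightarrow> 'a) \<Rightarrow> ('a \<Rightarrow> 'a)) set" where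
  "Hom_homeo \<Gamma> = hom (homeo_group\<lparr>carrier := \<Gamma>\<rparr>) homeo_group \<inter> extensional \<Gamma>"

text \<open>Pointwise convergence on \<open>A\<close>, to be used with a finite generating set \<open>A\<close> of \<open>\<Gamma>\<close>.\<close>

definition Hom_topology ::
  "('a::metric_space \<Rightarrow> 'a) set \<Rightarrow> ('a \<Rightarrow> 'a) set \<Rightarrow> (('a \<Rightarrow> 'a) \<Rightarrow> ('a \<Rightarrow> 'a)) topology" where
  "Hom_topology \<Gamma> A =
     pullback_topology (Hom_homeo \<Gamma>) (\<lambda>\<rho>. restrict \<rho> A) (product_topology (\<lambda>_. homeo_topology) A)"

definition inclusion_hom :: "('a \<Rightarrow> 'a) set \<Rightarrow> ('a \<Rightarrow> 'a) \<Rightarrow> ('a \<Rightarrow> 'a)" where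
  "inclusion_hom \<Gamma> = (\<lambda>g\<in>\<Gamma>. g)"

definition semi_conjugate ::
  "('a::metric_space \<Rightarrow> 'a) set \<Rightarrow> (('a \<Rightarrow> 'a) \<Rightarrow> ('a \<Rightarrow> 'a)) \<Rightarrow> (('a \<Rightarrow> 'a) \<Rightarrow> ('a \<Rightarrow> 'a)) \<Rightarrow> bool" where
  "semi_conjugate \<Gamma> \<rho> \<sigma> \<longleftrightarrow>
     (\<exists>\<phi>. continuous_on UNIV \<phi> \<and> surj \<phi> \<and> (\<forall>g\<in>\<Gamma>. \<phi> \<circ> \<rho> g = \<sigma> g \<circ> \<phi>))"

section \<open>Expanding actions and expanding data\<close>

definition expanding_homeo :: "real \<Rightarrow> 'a::metric_space set \<Rightarrow> real \<Rightarrow> ('a \<Rightarrow> 'a) \<Rightarrow> bool" where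
  "expanding_homeo lam U \<delta> f \<longleftrightarrow>
     lam > 1 \<and> \<delta> > 0 \<and> f \<in> carrier homeo_group \<and>
     (\<forall>x r. ball x r \<subseteq> U \<and> 0 < r \<and> r \<le> \<delta> \<longrightarrow> ball (f x) (lam * r) \<subseteq> f ` ball x r)"

definition expanding_at :: "('a::metric_space \<Rightarrow> 'a) \<Rightarrow> 'a \<Rightarrow> bool" where
  "expanding_at f x \<longleftrightarrow>
     (\<exists>U lam \<delta>. x \<in> interior U \<and> lam > 1 \<and> \<delta> > 0 \<and> expanding_homeo lam U \<delta> f)"

definition expanding_action :: "('a::metric_space \<Rightarrow> 'a) set \<Rightarrow> bool" where
  "expanding_action \<Gamma> \<longleftrightarrow> (\<forall>x. \<exists>\<gamma>\<in>\<Gamma>. expanding_at (inv_into UNIV \<gamma>) x)"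

text \<open>The fields \<open>cov\<close> and \<open>gen\<close> are relevant only on the index set \<open>{1..size_of D}\<close>.\<close>

record 'a datum =
  size_of :: nat
  cov :: "nat \<Rightarrow> 'a set"
  gen :: "nat \<Rightarrow> 'a \<Rightarrow> 'a"
  lam :: real
  del :: real

definition index_set :: "'a datum \<Rightarrow> nat set" where
  "index_set D = {1..size_of D}"

definition gens :: "'a datum \<Rightarrow> ('a \<Rightarrow> 'a) set" where
  "gens D = gen D ` index_set D"

definition expanding_datum :: "('a::metric_space \<Rightarrow> 'a) set \<Rightarrow> 'a datum \<Rightarrow> bool" where
  "expanding_datum \<Gamma> D \<longleftrightarrow>
     (\<forall>i\<in>index_set D. open (cov D i)) \<and> (\<Union>i\<in>index_set D. cov D i) = UNIV \<and>
     gens D \<subseteq> \<Gamma> \<and> inv_into UNIV ` gens D = gens D \<and> generate homeo_group (gens D) = \<Gamma> \<and>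
     lam D > 1 \<and> del D > 0 \<and>
     (\<forall>x. \<exists>i\<in>index_set D. ball x (del D) \<subseteq> cov D i) \<and>
     (\<forall>i\<in>index_set D. expanding_homeo (lam D) (cov D i) (del D) (inv_into UNIV (gen D i)))"

definition refinement :: "'a datum \<Rightarrow> 'a datum \<Rightarrow> bool" (infix \<open>\<prec>\<^sub>D\<close> 50) where
  "D \<prec>\<^sub>D D' \<longleftrightarrow>
     index_set D \<subseteq> index_set D' \<and>
     (\<forall>i\<in>index_set D. cov D i \<subseteq> cov D' i \<and> gen D i = gen D' i) \<and>
     0 < del D \<and> del D \<le> del D' \<and> lam D \<ge> lam D' \<and> lam D' > 1"

section \<open>Codes and rays\<close>

primrec orbit_pt :: "'a datum \<Rightarrow> (nat \<Rightarrow> nat) \<Rightarrow> 'a \<Rightarrow> nat \<Rightarrow> 'a" where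
  "orbit_pt D \<alpha> x 0 = x"
| "orbit_pt D \<alpha> x (Suc k) = inv_into UNIV (gen D (\<alpha> k)) (orbit_pt D \<alpha> x k)"

definition is_code :: "'a::metric_space datum \<Rightarrow> real \<Rightarrow> 'a \<Rightarrow> (nat \<Rightarrow> nat) \<Rightarrow> bool" where
  "is_code D \<eta> x \<alpha> \<longleftrightarrow>
     (\<forall>k. \<alpha> k \<in> index_set D) \<and> (\<forall>k\<ge>1. ball (orbit_pt D \<alpha> x k) \<eta> \<subseteq> cov D (\<alpha> k))"

primrec ray :: "'a datum \<Rightarrow> (nat \<Rightarrow> nat) \<Rightarrow> nat \<Rightarrow> 'a \<Rightarrow> 'a" where
  "ray D \<alpha> 0 = gen D (\<alpha> 0)"
| "ray D \<alpha> (Suc k) = ray D \<alpha> k \<circ> gen D (\<alpha> (Suc k))"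

definition Ray :: "'a::metric_space datum \<Rightarrow> real \<Rightarrow> 'a \<Rightarrow> (nat \<Rightarrow> 'a \<Rightarrow> 'a) set" where
  "Ray D \<eta> x = {ray D \<alpha> |\<alpha>. is_code D \<eta> x \<alpha>}"

lemma Ray_refinement:
  assumes "D \<prec>\<^sub>D D'"
  shows "Ray D \<eta> x \<subseteq> Ray D' \<eta> x"
proof
  fix r assume "r \<in> Ray D \<eta> x"
  then obtain \<alpha> where \<alpha>: "is_code D \<eta> x \<alpha>" and r: "r = ray D \<alpha>" by (auto simp: Ray_def)
  have g: "gen D (\<alpha> k) = gen D' (\<alpha> k)" for k
    using assms \<alpha> by (auto simp: refinement_def is_code_def)
  have "ray D \<alpha> k = ray D' \<alpha> k" for k by (induction k) (simp_all add: g)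
  then have "r = ray D' \<alpha>" using r by auto
  moreover have "orbit_pt D \<alpha> x k = orbit_pt D' \<alpha> x k" for k by (induction k) (simp_all add: g)
  then have "is_code D' \<eta> x \<alpha>"
    using assms \<alpha> by (simp add: is_code_def refinement_def) (metis subset_iff)
  ultimately show "r \<in> Ray D' \<eta> x" by (auto simp: Ray_def)
qed

section \<open>Word metrics and meandering hyperbolicity\<close>

definition word_length :: "('a \<Rightarrow> 'a) set \<Rightarrow> ('a \<Rightarrow> 'a) \<Rightarrow> nat" where
  "word_length S g =
     (LEAST n. \<exists>ws. length ws = n \<and> set ws \<subseteq> S \<union> inv_into UNIV ` S \<and> g = foldr (\<circ>) ws id)"

definition word_dist :: "('a \<Rightarrow> 'a) set \<Rightarrow> ('a \<Rightarrow> 'a) \<Rightarrow> ('a \<Rightarrow> 'a) \<Rightarrow> real" where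
  "word_dist S g h = real (word_length S (inv_into UNIV g \<circ> h))"

text \<open>Extended-real valued, since rays are typically unbounded subsets of the group.\<close>

definition hausdorff_distance :: "('b \<Rightarrow> 'b \<Rightarrow> real) \<Rightarrow> 'b set \<Rightarrow> 'b set \<Rightarrow> ereal" where
  "hausdorff_distance d A B =
     max (SUP a\<in>A. INF b\<in>B. ereal (d a b)) (SUP b\<in>B. INF a\<in>A. ereal (d a b))"

definition L_close ::
  "'a::metric_space datum \<Rightarrow> real \<Rightarrow> 'a \<Rightarrow> real \<Rightarrow> (nat \<Rightarrow> 'a \<Rightarrow> 'a) \<Rightarrow> (nat \<Rightarrow> 'a \<Rightarrow> 'a) \<Rightarrow> bool" where
  "L_close D \<eta> x L r q \<longleftrightarrow>
     r \<in> Ray D \<eta> x \<and> q \<in> Ray D \<eta> x \<and>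
     (\<exists>P Q. infinite P \<and> infinite Q \<and>
        hausdorff_distance (word_dist (gens D)) (r ` P) (q ` Q) \<le> ereal L)"

definition L_equivalent ::
  "'a::metric_space datum \<Rightarrow> real \<Rightarrow> 'a \<Rightarrow> real \<Rightarrow> (nat \<Rightarrow> 'a \<Rightarrow> 'a) \<Rightarrow> (nat \<Rightarrow> 'a \<Rightarrow> 'a) \<Rightarrow> bool" where
  "L_equivalent D \<eta> x L r q \<longleftrightarrow>
     r \<in> Ray D \<eta> x \<and> q \<in> Ray D \<eta> x \<and> equivclp (L_close D \<eta> x L) r q"

definition meandering_hyperbolic :: "('a::metric_space \<Rightarrow> 'a) set \<Rightarrow> bool" where
  "meandering_hyperbolic \<Gamma> \<longleftrightarrow>
     expanding_action \<Gamma> \<and>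
     (\<exists>D. expanding_datum \<Gamma> D \<and>
       (\<exists>D' L. expanding_datum \<Gamma> D' \<and> D \<prec>\<^sub>D D' \<and> L \<ge> 0 \<and>
         (\<forall>x \<eta>. 0 < \<eta> \<and> \<eta> \<le> del D \<longrightarrow>
           (\<forall>r\<in>Ray D \<eta> x. \<forall>q\<in>Ray D \<eta> x. L_equivalent D' \<eta> x L r q))))"

end

theory Submission
  imports Defs
begin

text \<open>Let \<open>\<rho>\<close> be close to the inclusion. For a code of \<open>x\<close> with ray \<open>r\<close>, consider the set of all \<open>y\<close> whose
  \<open>\<rho>\<close>-orbit along \<open>r\<close> stays \<open>R\<close>-close to the orbit of \<open>x\<close>. The generators contract along a code when
  read backwards, and \<open>\<rho>\<close> only adds an error absorbed by \<open>R\<close>; so the set is nonempty by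
  compactness, and it is enough that the two orbits are \<open>\<eta> / 2\<close>-close at infinitely many times.
  Rays that are \<open>L\<close>-close differ infinitely often by one of finitely many words, hence define the same
  set, and meandering hyperbolicity makes the set depend on \<open>x\<close> only. This gives \<open>\<rho>\<close>-equivariance, so
  that \<open>y\<close> in the set of \<open>x\<close> satisfies \<open>d(\<rho>(g) y, g x) \<le> R\<close> for all \<open>g\<close>. Every \<open>y\<close> occurs, because its
  \<open>\<rho>\<close>-orbit is a pseudo-orbit of \<open>\<Gamma>\<close> and is shadowed by that of some \<open>x\<close>. By expansivity the closed
  relation \<open>\<forall>g. d(\<rho>(g) y, g x) \<le> R\<close> is the graph of a map \<open>y \<mapsto> x\<close>, the semi-conjugacy. It goes from
  the \<open>\<rho>\<close>-action to the original one, so \<open>\<rho>\<close> itself need not be expanding.\<close>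

section \<open>Representations by homeomorphisms\<close>

lemma inv_homeo_group:
  assumes "f \<in> carrier homeo_group"
  shows "inv\<^bsub>homeo_group\<^esub> f = inv_into UNIV f"
proof (rule group.inv_equality[OF group_homeo_group _ assms])
  have "bij f" using assms in_homeo_group_iff by blast
  then show "inv_into UNIV f \<otimes>\<^bsub>homeo_group\<^esub> f = \<one>\<^bsub>homeo_group\<^esub>"
    by (simp add: bij_is_inj homeo_group_def)
  show "inv_into UNIV f \<in> carrier homeo_group"
    using assms by (simp add: in_homeo_group_iff bij_imp_bij_inv inv_inv_eq)
qed

locale homeo_subgroup =
  fixes \<Gamma> :: "('a::metric_space \<Rightarrow> 'a) set"
  assumes subgroup: "subgroup \<Gamma> homeo_group"
begin

lemma mem_homeo: "g \<in> \<Gamma> \<Longrightarrow> g \<in> carrier homeo_group"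
  using subgroup by (meson subgroup.mem_carrier)

lemma bij: "g \<in> \<Gamma> \<Longrightarrow> bij g"
  using mem_homeo in_homeo_group_iff by blast

lemma cont: "g \<in> \<Gamma> \<Longrightarrow> continuous_on UNIV g"
  using mem_homeo in_homeo_group_iff by blast

lemma id_mem: "id \<in> \<Gamma>"
  using subgroup.one_closed[OF subgroup] by (simp add: homeo_group_def)

lemma comp_mem: "g \<in> \<Gamma> \<Longrightarrow> h \<in> \<Gamma> \<Longrightarrow> g \<circ> h \<in> \<Gamma>"
  using subgroup.m_closed[OF subgroup, of g h] by (simp add: homeo_group_def)

lemma inv_mem: "g \<in> \<Gamma> \<Longrightarrow> inv_into UNIV g \<in> \<Gamma>"
  using subgroup.m_inv_closed[OF subgroup, of g] by (simp add: inv_homeo_group mem_homeo)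

lemma inv_apply: "g \<in> \<Gamma> \<Longrightarrow> inv_into UNIV g (g x) = x"
  by (simp add: bij bij_is_inj)

lemma apply_inv: "g \<in> \<Gamma> \<Longrightarrow> g (inv_into UNIV g x) = x"
  by (simp add: bij bij_is_surj surj_f_inv_f)

lemma inv_inv: "g \<in> \<Gamma> \<Longrightarrow> inv_into UNIV (inv_into UNIV g) = g"
  by (simp add: bij inv_inv_eq)

lemma inv_comp: "g \<in> \<Gamma> \<Longrightarrow> h \<in> \<Gamma> \<Longrightarrow> inv_into UNIV (g \<circ> h) = inv_into UNIV h \<circ> inv_into UNIV g"
  by (simp add: bij o_inv_distrib)

end

locale homeo_rep = homeo_subgroup \<Gamma> for \<Gamma> :: "('a::metric_space \<Rightarrow> 'a) set" +
  fixes \<rho> :: "('a \<Rightarrow> 'a) \<Rightarrow> 'a \<Rightarrow> 'a"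
  assumes rep: "\<rho> \<in> Hom_homeo \<Gamma>"
begin

lemma rep_homeo: "g \<in> \<Gamma> \<Longrightarrow> \<rho> g \<in> carrier homeo_group"
  using rep by (auto simp: Hom_homeo_def hom_def)

lemma rep_cont: "g \<in> \<Gamma> \<Longrightarrow> continuous_on UNIV (\<rho> g)"
  using rep_homeo in_homeo_group_iff by blast

lemma rep_comp: "g \<in> \<Gamma> \<Longrightarrow> h \<in> \<Gamma> \<Longrightarrow> \<rho> (g \<circ> h) = \<rho> g \<circ> \<rho> h"
  using rep by (auto simp: Hom_homeo_def hom_def homeo_group_def)

lemma rep_id: "\<rho> id = id"
proof
  fix x
  have "\<rho> id (\<rho> id x) = \<rho> id x"
    using rep_comp[OF id_mem id_mem] by (metis comp_apply id_comp)
  then show "\<rho> id x = id x"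
    using rep_homeo[OF id_mem] by (metis bij_pointE id_apply in_homeo_group_iff)
qed

lemma rep_inv_apply: "g \<in> \<Gamma> \<Longrightarrow> \<rho> (inv_into UNIV g) (\<rho> g x) = x"
  using rep_comp[OF inv_mem, of g g] rep_id bij[of g]
  by (metis bij_is_inj comp_apply id_apply inv_o_cancel)

lemma rep_apply_inv: "g \<in> \<Gamma> \<Longrightarrow> \<rho> g (\<rho> (inv_into UNIV g) x) = x"
  using rep_inv_apply[OF inv_mem, of g] inv_inv by simp

lemma inv_rep: "g \<in> \<Gamma> \<Longrightarrow> inv_into UNIV (\<rho> g) = \<rho> (inv_into UNIV g)"
  by (rule inv_equality) (simp_all add: rep_inv_apply rep_apply_inv)

end

section \<open>Neighborhoods in the C0 topology on representations\<close>

text \<open>Induction on the generation of \<open>g\<close> from \<open>A\<close>: closeness on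
  \<open>A\<close> spreads to each fixed \<open>g\<close>. The resulting \<open>e\<close> depends on
  \<open>g\<close> and \<open>\<epsilon>\<close>, but not on \<open>\<rho>\<close>.\<close>

lemma rep_near_on_generated:
  fixes \<Gamma> A :: "('a::metric_space \<Rightarrow> 'a) set"
  assumes "compact (UNIV :: 'a set)" and "homeo_subgroup \<Gamma>"
    and "A \<subseteq> \<Gamma>" and "generate homeo_group A = \<Gamma>" and "g \<in> \<Gamma>" and "0 < \<epsilon>"
  shows "\<exists>e>0. \<forall>\<rho>\<in>Hom_homeo \<Gamma>. (\<forall>a\<in>A. C0_dist (\<rho> a) a < e) \<longrightarrow>
           (\<forall>x. dist (\<rho> g x) (g x) \<le> \<epsilon>)"
proof -
  interpret homeo_subgroup \<Gamma> by fact
  have bdd: "bdd_above (range (\<lambda>x. dist (f x) (g x)))" for f g :: "'a \<Rightarrow> 'a"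
    using diameter_bounded_bound[OF compact_imp_bounded[OF assms(1)]]
    by (auto intro!: bdd_aboveI2)
  have le: "dist (f x) (g x) \<le> (SUP x. dist (f x) (g x))" for f g :: "'a \<Rightarrow> 'a" and x
    by (rule cSUP_upper[OF UNIV_I bdd])
  have nn: "0 \<le> (SUP x. dist (f x) (g x))" for f g :: "'a \<Rightarrow> 'a"
    using le[of f undefined g] by (meson order_trans zero_le_dist)
  have near: "dist (f x) (g x) \<le> C0_dist f g"
    "dist (inv_into UNIV f x) (inv_into UNIV g x) \<le> C0_dist f g" for f g :: "'a \<Rightarrow> 'a" and x
    using nn[of f g] nn[of "inv_into UNIV f" "inv_into UNIV g"] le[of f x g]
      le[of "inv_into UNIV f" x "inv_into UNIV g"] by (simp_all add: C0_dist_def)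
  have "g \<in> generate homeo_group A" using assms by simp
  then show ?thesis using \<open>0 < \<epsilon>\<close>
  proof (induction arbitrary: \<epsilon> rule: generate.induct)
    case one
    have "\<forall>\<rho>\<in>Hom_homeo \<Gamma>. \<forall>x. dist (\<rho> id x) (id x) \<le> \<epsilon>"
    proof (intro ballI allI)
      fix \<rho> x assume "\<rho> \<in> Hom_homeo \<Gamma>"
      then interpret homeo_rep \<Gamma> \<rho> by unfold_locales
      show "dist (\<rho> id x) (id x) \<le> \<epsilon>" using one by (simp add: rep_id)
    qed
    moreover have "\<one>\<^bsub>homeo_group\<^esub> = (id :: 'a \<Rightarrow> 'a)" by (simp add: homeo_group_def)
    ultimately show ?case by (metis zero_less_one)
  next
    case (incl h)
    then show ?case by (metis near(1) less_imp_le order_trans)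
  next
    \<comment> \<open>\<open>C0_dist\<close> also measures the inverse maps, so an inverse costs no
      further estimate.\<close>
    case (inv h)
    have "\<forall>\<rho>\<in>Hom_homeo \<Gamma>. (\<forall>a\<in>A. C0_dist (\<rho> a) a < \<epsilon>) \<longrightarrow>
        (\<forall>x. dist (\<rho> (inv_into UNIV h) x) (inv_into UNIV h x) \<le> \<epsilon>)"
    proof (intro ballI allI impI)
      fix \<rho> x assume "\<rho> \<in> Hom_homeo \<Gamma>" and c: "\<forall>a\<in>A. C0_dist (\<rho> a) a < \<epsilon>"
      then interpret homeo_rep \<Gamma> \<rho> by unfold_locales
      have "\<rho> (inv_into UNIV h) = inv_into UNIV (\<rho> h)" using inv assms(3) by (simp add: inv_rep subsetD)
      then show "dist (\<rho> (inv_into UNIV h) x) (inv_into UNIV h x) \<le> \<epsilon>"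
        using near(2)[of "\<rho> h" x h] c inv(1) by (metis less_imp_le order_trans)
    qed
    moreover have "inv\<^bsub>homeo_group\<^esub> h = inv_into UNIV h"
      using inv assms(3) by (simp add: inv_homeo_group mem_homeo subsetD)
    ultimately show ?case using inv by auto
  next
    case (eng g h)
    have mem: "g \<in> \<Gamma>" "h \<in> \<Gamma>" using eng assms(4) by auto
    \<comment> \<open>The modulus of continuity of \<open>g\<close> becomes the tolerance for
      \<open>h\<close>; hence \<open>\<epsilon>\<close> must be arbitrary in the induction.\<close>
    have "uniformly_continuous_on UNIV g"
      using compact_uniformly_continuous[OF cont assms(1)] mem by blast
    then obtain d where d: "d > 0" "\<And>x y. dist x y < d \<Longrightarrow> dist (g x) (g y) < \<epsilon> / 2"
      unfolding uniformly_continuous_on_def using eng.prems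
      by (metis UNIV_I half_gt_zero)
    obtain e1 where e1: "e1 > 0" "\<And>\<rho> x. \<rho> \<in> Hom_homeo \<Gamma> \<Longrightarrow> \<forall>a\<in>A. C0_dist (\<rho> a) a < e1 \<Longrightarrow>
        dist (\<rho> g x) (g x) \<le> \<epsilon> / 2"
      using eng.IH(1)[of "\<epsilon> / 2"] eng.prems by auto
    obtain e2 where e2: "e2 > 0" "\<And>\<rho> x. \<rho> \<in> Hom_homeo \<Gamma> \<Longrightarrow> \<forall>a\<in>A. C0_dist (\<rho> a) a < e2 \<Longrightarrow>
        dist (\<rho> h x) (h x) \<le> d / 2"
      using eng.IH(2)[of "d / 2"] d(1) by auto
    have "\<forall>\<rho>\<in>Hom_homeo \<Gamma>. (\<forall>a\<in>A. C0_dist (\<rho> a) a < min e1 e2) \<longrightarrow>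
        (\<forall>x. dist (\<rho> (g \<circ> h) x) ((g \<circ> h) x) \<le> \<epsilon>)"
    proof (intro ballI allI impI)
      fix \<rho> x assume r: "\<rho> \<in> Hom_homeo \<Gamma>" and c: "\<forall>a\<in>A. C0_dist (\<rho> a) a < min e1 e2"
      then interpret homeo_rep \<Gamma> \<rho> by unfold_locales
      have "dist (\<rho> h x) (h x) < d" using e2(2)[OF r, of x] c d(1) by force
      then have "dist (g (\<rho> h x)) (g (h x)) < \<epsilon> / 2" by (rule d(2))
      moreover have "dist (\<rho> g (\<rho> h x)) (g (\<rho> h x)) \<le> \<epsilon> / 2" using e1(2)[OF r] c by simp
      ultimately have "dist (\<rho> g (\<rho> h x)) (g (h x)) \<le> \<epsilon>"
        using dist_triangle[of "\<rho> g (\<rho> h x)" "g (h x)" "g (\<rho> h x)"] by linarith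
      then show "dist (\<rho> (g \<circ> h) x) ((g \<circ> h) x) \<le> \<epsilon>" by (simp add: rep_comp mem)
    qed
    moreover have "g \<otimes>\<^bsub>homeo_group\<^esub> h = g \<circ> h" by (simp add: homeo_group_def)
    ultimately show ?case using e1(1) e2(1) by (metis min_less_iff_conj)
  qed
qed

text \<open>Since \<open>A\<close> is finite, the product of metric balls is open, and the set is
  its preimage under restriction to \<open>A\<close>.\<close>

lemma openin_C0_neighborhood:
  fixes \<Gamma> A :: "('a::metric_space \<Rightarrow> 'a) set"
  assumes "compact (UNIV :: 'a set)" and "finite A" and "A \<subseteq> \<Gamma>" and "\<Gamma> \<subseteq> carrier homeo_group"
  shows "openin (Hom_topology \<Gamma> A) {\<rho> \<in> Hom_homeo \<Gamma>. \<forall>a\<in>A. C0_dist (\<rho> a) a < e}"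
proof -
  interpret Metric_space "carrier homeo_group" "C0_dist :: ('a \<Rightarrow> 'a) \<Rightarrow> _"
    by (rule Metric_space_C0_dist) fact
  let ?B = "\<Pi>\<^sub>E a\<in>A. mball a e"
  have "openin (product_topology (\<lambda>_. homeo_topology) A) ?B"
    using assms(2) by (simp add: openin_PiE_gen homeo_topology_def)
  moreover have "{\<rho> \<in> Hom_homeo \<Gamma>. \<forall>a\<in>A. C0_dist (\<rho> a) a < e} =
      (\<lambda>\<rho>. restrict \<rho> A) -` ?B \<inter> Hom_homeo \<Gamma>"
    using assms(3,4) by (auto simp: PiE_iff Hom_homeo_def hom_def commute subset_iff Pi_iff)
  ultimately show ?thesis
    unfolding Hom_topology_def openin_pullback_topology by blast
qed

lemma inclusion_hom_mem:
  assumes "subgroup \<Gamma> homeo_group"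
  shows "inclusion_hom \<Gamma> \<in> Hom_homeo \<Gamma>"
  using subgroup.mem_carrier[OF assms] subgroup.m_closed[OF assms]
  by (auto simp: inclusion_hom_def Hom_homeo_def hom_def)

section \<open>Words\<close>

context homeo_subgroup
begin

lemma foldr_comp_append: "foldr (\<circ>) (us @ vs) id = foldr (\<circ>) us id \<circ> foldr (\<circ>) vs id"
  by (induction us) (auto simp: comp_assoc)

lemma foldr_comp_mem: "set ws \<subseteq> \<Gamma> \<Longrightarrow> foldr (\<circ>) ws id \<in> \<Gamma>"
  by (induction ws) (auto simp: id_mem comp_mem)

lemma word_of_generated:
  assumes "S \<subseteq> \<Gamma>" and "g \<in> generate homeo_group S"
  shows "\<exists>ws. set ws \<subseteq> S \<union> inv_into UNIV ` S \<and> g = foldr (\<circ>) ws id"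
  using assms(2)
proof (induction rule: generate.induct)
  case one
  show ?case by (rule exI[of _ "[]"]) (simp add: homeo_group_def)
next
  case (incl h)
  then show ?case by (intro exI[of _ "[h]"]) simp
next
  case (inv h)
  then have "inv\<^bsub>homeo_group\<^esub> h = inv_into UNIV h"
    using assms(1) by (simp add: inv_homeo_group mem_homeo subsetD)
  then show ?case using inv by (intro exI[of _ "[inv_into UNIV h]"]) simp
next
  case (eng g h)
  then obtain us vs where "set us \<subseteq> S \<union> inv_into UNIV ` S" "g = foldr (\<circ>) us id"
    "set vs \<subseteq> S \<union> inv_into UNIV ` S" "h = foldr (\<circ>) vs id" by blast
  then show ?case
    by (intro exI[of _ "us @ vs"]) (simp only: foldr_comp_append set_append Un_least homeo_group_def monoid.simps)
qed

text \<open>There are finitely many words of bounded length over a finite alphabet.\<close>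

lemma finite_word_length_le:
  assumes "finite S" and "S \<subseteq> \<Gamma>" and "generate homeo_group S = \<Gamma>"
  shows "finite {g \<in> \<Gamma>. real (word_length S g) \<le> L}"
proof -
  let ?T = "S \<union> inv_into UNIV ` S"
  have "{g \<in> \<Gamma>. real (word_length S g) \<le> L} \<subseteq>
      (\<lambda>ws. foldr (\<circ>) ws id) ` {ws. set ws \<subseteq> ?T \<and> length ws \<le> nat \<lfloor>L\<rfloor>}"
  proof
    fix g assume g: "g \<in> {g \<in> \<Gamma>. real (word_length S g) \<le> L}"
    \<comment> \<open>A word exists because \<open>S\<close> generates; this makes the
      \<open>LEAST\<close> in \<open>word_length\<close> attained.\<close>
    then have "\<exists>n ws. length ws = n \<and> set ws \<subseteq> ?T \<and> g = foldr (\<circ>) ws id"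
      using word_of_generated[of S g] assms by simp
    then have "\<exists>ws. length ws = word_length S g \<and> set ws \<subseteq> ?T \<and> g = foldr (\<circ>) ws id"
      unfolding word_length_def by (rule LeastI_ex)
    then obtain ws where ws: "length ws = word_length S g" "set ws \<subseteq> ?T" "g = foldr (\<circ>) ws id"
      by blast
    have "length ws \<le> nat \<lfloor>L\<rfloor>" using g ws(1) by (simp add: le_nat_floor)
    then show "g \<in> (\<lambda>ws. foldr (\<circ>) ws id) ` {ws. set ws \<subseteq> ?T \<and> length ws \<le> nat \<lfloor>L\<rfloor>}"
      using ws by blast
  qed
  then show ?thesis
    using finite_lists_length_le[of ?T "nat \<lfloor>L\<rfloor>"] assms(1) finite_surj by blast
qed

end

text \<open>Word distances are natural numbers, so an infimum bounded by \<open>L\<close> is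
  attained by an element within \<open>L\<close>, with no loss of an epsilon.\<close>

lemma hausdorff_distance_word_dist_le:
  assumes "hausdorff_distance (word_dist S) A B \<le> ereal L"
  shows "a \<in> A \<Longrightarrow> \<exists>b\<in>B. word_dist S a b \<le> L" and "b \<in> B \<Longrightarrow> \<exists>a\<in>A. word_dist S a b \<le> L"
proof -
  have attained: "\<exists>n\<in>N. real (f n) \<le> L" if "(INF n\<in>N. ereal (real (f n))) \<le> ereal L"
    for N :: "'b set" and f :: "'b \<Rightarrow> nat"
  proof (rule ccontr)
    assume "\<not> (\<exists>n\<in>N. real (f n) \<le> L)"
    then have gt: "L < real (f n)" if "n \<in> N" for n using that by force
    \<comment> \<open>Values above \<open>L\<close> are at least the next integer after
      \<open>L\<close>, which therefore bounds the infimum from below.\<close>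
    have "ereal (real_of_int (\<lfloor>L\<rfloor> + 1)) \<le> ereal (real (f n))" if "n \<in> N" for n
    proof -
      have "\<lfloor>L\<rfloor> < int (f n)" using gt[OF that] by (simp add: floor_less_iff)
      then have "\<lfloor>L\<rfloor> + 1 \<le> int (f n)" by simp
      then have "real_of_int (\<lfloor>L\<rfloor> + 1) \<le> real_of_int (int (f n))" by (simp only: of_int_le_iff)
      then show ?thesis by simp
    qed
    then have "ereal (real_of_int (\<lfloor>L\<rfloor> + 1)) \<le> (INF n\<in>N. ereal (real (f n)))"
      by (rule INF_greatest)
    then have "ereal (real_of_int (\<lfloor>L\<rfloor> + 1)) \<le> ereal L" using that by (rule order_trans)
    moreover have "L < real_of_int (\<lfloor>L\<rfloor> + 1)" by linarith
    ultimately show False by simp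
  qed
  have 1: "(SUP a\<in>A. INF b\<in>B. ereal (word_dist S a b)) \<le> ereal L"
    and 2: "(SUP b\<in>B. INF a\<in>A. ereal (word_dist S a b)) \<le> ereal L"
    using assms by (simp_all add: hausdorff_distance_def)
  show "\<exists>b\<in>B. word_dist S a b \<le> L" if "a \<in> A"
    using order_trans[OF SUP_upper[OF that] 1] unfolding word_dist_def by (rule attained)
  show "\<exists>a\<in>A. word_dist S a b \<le> L" if "b \<in> B"
    using order_trans[OF SUP_upper[OF that] 2] unfolding word_dist_def by (rule attained)
qed

section \<open>Contraction along rays\<close>

text \<open>For \<open>t\<close> slightly above \<open>dist p (f z) / l\<close>, expansion puts
  \<open>p\<close> into the image of \<open>ball z t\<close>. The slack is needed because balls are
  open; letting \<open>t\<close> decrease gives the bound.\<close>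

lemma expanding_homeo_contraction:
  assumes "expanding_homeo l U \<delta> f" and "ball z \<eta> \<subseteq> U" and "0 < \<eta>" and "\<eta> \<le> \<delta>"
    and "dist p (f z) \<le> \<eta>"
  shows "dist (inv_into UNIV f p) z \<le> dist p (f z) / l"
proof (rule dense_ge_bounded)
  have l: "l > 1" and f: "bij f" using assms(1) by (auto simp: expanding_homeo_def in_homeo_group_iff)
  have "\<eta> * 1 < \<eta> * l" using l assms(3) by (intro mult_strict_left_mono)
  then show "dist p (f z) / l < \<eta>" using l assms(5) by (simp add: divide_less_eq)
  fix t assume t: "dist p (f z) / l < t" "t < \<eta>"
  have "0 \<le> dist p (f z) / l" using l by simp
  then have "t > 0" using t by linarith
  moreover have "ball z t \<subseteq> U" using assms(2) t by (meson less_imp_le order_trans subset_ball)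
  ultimately have "ball (f z) (l * t) \<subseteq> f ` ball z t"
    using assms(1,4) t by (auto simp: expanding_homeo_def)
  moreover have "p \<in> ball (f z) (l * t)" using t l by (simp add: divide_less_eq dist_commute mult.commute)
  ultimately obtain q where "q \<in> ball z t" "p = f q" by blast
  then show "dist (inv_into UNIV f p) z \<le> t" using f by (simp add: bij_is_inj dist_commute)
qed

text \<open>\<open>R\<close> is the fixed point of \<open>u / l + R * (1 - 1 / l)\<close>, so each
  backward step divides the excess over \<open>R\<close> by \<open>l\<close>. The excess never grows
  beyond \<open>c\<close>, so the threshold \<open>\<eta>\<close> is respected throughout.\<close>

lemma backward_contraction:
  fixes a :: "nat \<Rightarrow> real"
  assumes "l > 1" and "0 \<le> c" and "R + c \<le> \<eta>"
    and step: "\<And>k. a (Suc k) \<le> \<eta> \<Longrightarrow> a k \<le> a (Suc k) / l + R * (1 - 1 / l)"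
    and "a (i + n) \<le> R + c"
  shows "a i \<le> R + c / l ^ n"
  using assms(5)
proof (induction n arbitrary: i)
  case (Suc n)
  then have a: "a (Suc i) \<le> R + c / l ^ n" by simp
  have "c / l ^ n \<le> c"
    using assms(1,2) by (simp add: divide_le_eq mult_le_cancel_left1 one_le_power)
  then have "a (Suc i) \<le> \<eta>" using a assms(3) by linarith
  then have "a i \<le> a (Suc i) / l + R * (1 - 1 / l)" by (rule step)
  also have "\<dots> \<le> (R + c / l ^ n) / l + R * (1 - 1 / l)"
    using a assms(1) by (simp add: divide_right_mono)
  also have "\<dots> = R + c / l ^ Suc n" using assms(1) by (simp add: field_simps)
  finally show ?case .
qed simp

text \<open>The preimage of a closed set is the projection of a compact piece of the graph.\<close>

lemma continuous_on_closed_graph: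
  fixes f :: "'a::metric_space \<Rightarrow> 'b::metric_space"
  assumes "compact (UNIV :: 'a set)" and "compact (UNIV :: 'b set)" and "closed {(y, x). x = f y}"
  shows "continuous_on UNIV f"
proof -
  have "closed (f -` C)" if "closed C" for C
  proof -
    have "compact ((UNIV \<times> UNIV) \<inter> ({(y, x). x = f y} \<inter> (UNIV \<times> C)))"
      using assms that by (intro compact_Int_closed compact_Times closed_Int closed_Times) auto
    then have "compact (fst ` ({(y, x). x = f y} \<inter> (UNIV \<times> C)))"
      by (intro compact_continuous_image continuous_on_fst continuous_on_id) simp
    moreover have "fst ` ({(y, x). x = f y} \<inter> (UNIV \<times> C)) = f -` C" by force
    ultimately show ?thesis by (simp add: compact_imp_closed)
  qed
  then show ?thesis by (simp add: continuous_on_closed_vimage)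
qed

section \<open>Shadowing and the semi-conjugacy\<close>

text \<open>\<open>near_gens\<close> allows exactly the error per step that contraction by
  \<open>lam D'\<close> absorbs at scale \<open>R\<close>. \<open>near_words\<close> serves the
  comparison of \<open>L\<close>-close rays, in both directions. With \<open>\<eta>\<close> half of
  \<open>del D\<close>, points shadowing an orbit still see its charts.\<close>

locale meandering_perturbation = homeo_rep \<Gamma> \<rho>
  for \<Gamma> :: "('a::metric_space \<Rightarrow> 'a) set" and \<rho> :: "('a \<Rightarrow> 'a) \<Rightarrow> 'a \<Rightarrow> 'a" +
  fixes D D' :: "'a datum" and L \<eta> R :: real
  assumes compact: "compact (UNIV :: 'a set)"
    and datum: "expanding_datum \<Gamma> D" and datum': "expanding_datum \<Gamma> D'" and refines: "D \<prec>\<^sub>D D'"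
    and rays_equivalent: "\<And>x r q. r \<in> Ray D \<eta> x \<Longrightarrow> q \<in> Ray D \<eta> x \<Longrightarrow> L_equivalent D' \<eta> x L r q"
    and eta: "\<eta> = del D / 2" and R_pos: "0 < R" and R_le: "R \<le> \<eta> / 2"
    and near_words: "\<And>w p q. w \<in> \<Gamma> \<Longrightarrow> real (word_length (gens D') w) \<le> L \<Longrightarrow> dist p q \<le> R \<Longrightarrow>
      dist (\<rho> w p) (w q) \<le> \<eta> / 2 \<and> dist (\<rho> (inv_into UNIV w) p) (inv_into UNIV w q) \<le> \<eta> / 2"
    and near_gens: "\<And>s x. s \<in> gens D' \<Longrightarrow> dist (\<rho> s x) (s x) \<le> R * (1 - 1 / lam D')"
begin

section \<open>Contraction by the generators of the refined datum\<close>

lemma eta_pos: "0 < \<eta>" and eta_le: "\<eta> \<le> del D'" and lam_gt: "lam D' > 1"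
  using R_pos R_le refines eta by (auto simp: refinement_def)

lemma gen_mem: "i \<in> index_set D' \<Longrightarrow> gen D' i \<in> \<Gamma>"
  using datum' by (auto simp: expanding_datum_def gens_def)

lemma inv_gen_mem: "i \<in> index_set D' \<Longrightarrow> inv_into UNIV (gen D' i) \<in> gens D'"
  using datum' by (auto simp: expanding_datum_def gens_def)

lemma index_refine: "i \<in> index_set D \<Longrightarrow> i \<in> index_set D'"
  and gen_refine: "i \<in> index_set D \<Longrightarrow> gen D i = gen D' i"
  and cov_refine: "i \<in> index_set D \<Longrightarrow> cov D i \<subseteq> cov D' i"
  using refines by (auto simp: refinement_def)

text \<open>The expanding map is the inverse of the generator, so the generator itself
  contracts.\<close>

lemma gen_contraction:
  assumes "i \<in> index_set D'" and "ball z \<eta> \<subseteq> cov D' i" and "dist p (inv_into UNIV (gen D' i) z) \<le> \<eta>"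
  shows "dist (gen D' i p) z \<le> dist p (inv_into UNIV (gen D' i) z) / lam D'"
proof -
  have "expanding_homeo (lam D') (cov D' i) (del D') (inv_into UNIV (gen D' i))"
    using assms(1) datum' by (simp add: expanding_datum_def)
  from expanding_homeo_contraction[OF this assms(2) eta_pos eta_le assms(3)]
  show ?thesis using assms(1) by (simp add: inv_inv gen_mem)
qed

lemma rep_gen_contraction:
  assumes "i \<in> index_set D'" and "ball z \<eta> \<subseteq> cov D' i" and "dist p (inv_into UNIV (gen D' i) z) \<le> \<eta>"
  shows "dist (\<rho> (gen D' i) p) z \<le> dist p (inv_into UNIV (gen D' i) z) / lam D' + R * (1 - 1 / lam D')"
proof -
  have "dist (\<rho> (gen D' i) p) (gen D' i p) \<le> R * (1 - 1 / lam D')"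
    using near_gens[of "gen D' i" p] assms(1) by (simp add: gens_def)
  then show ?thesis
    using gen_contraction[OF assms] dist_triangle[of "\<rho> (gen D' i) p" z "gen D' i p"] by linarith
qed

lemma is_code_refine:
  assumes "is_code D \<eta> x \<alpha>"
  shows "is_code D' \<eta> x \<alpha>" and "ray D \<alpha> = ray D' \<alpha>" and "orbit_pt D \<alpha> x = orbit_pt D' \<alpha> x"
proof -
  have i: "\<alpha> k \<in> index_set D" for k using assms by (simp add: is_code_def)
  have "ray D \<alpha> k = ray D' \<alpha> k" for k by (induction k) (simp_all add: gen_refine i)
  then show "ray D \<alpha> = ray D' \<alpha>" by blast
  have "orbit_pt D \<alpha> x k = orbit_pt D' \<alpha> x k" for k by (induction k) (simp_all add: gen_refine i)
  then show "orbit_pt D \<alpha> x = orbit_pt D' \<alpha> x" by blast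
  then show "is_code D' \<eta> x \<alpha>"
    using assms cov_refine[OF i] index_refine[OF i] unfolding is_code_def by (metis order_trans)
qed

lemma ray_mem:
  assumes "\<And>k. \<alpha> k \<in> index_set D'"
  shows "ray D' \<alpha> k \<in> \<Gamma>"
  by (induction k) (simp_all only: ray.simps gen_mem comp_mem assms)

text \<open>The shift by one arises because the ray at time \<open>k\<close> already contains
  \<open>k + 1\<close> generators.\<close>

lemma inv_ray:
  assumes "\<And>k. \<alpha> k \<in> index_set D'"
  shows "inv_into UNIV (ray D' \<alpha> k) x = orbit_pt D' \<alpha> x (Suc k)"
proof (induction k)
  case (Suc k)
  have "inv_into UNIV (ray D' \<alpha> (Suc k)) = inv_into UNIV (gen D' (\<alpha> (Suc k))) \<circ> inv_into UNIV (ray D' \<alpha> k)"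
    by (simp only: ray.simps inv_comp ray_mem gen_mem assms)
  then show ?case using Suc by (simp only: comp_apply orbit_pt.simps)
qed simp

lemma rep_ray_Suc:
  assumes "\<And>k. \<alpha> k \<in> index_set D'"
  shows "\<rho> (inv_into UNIV (ray D' \<alpha> (Suc k))) y =
    \<rho> (inv_into UNIV (gen D' (\<alpha> (Suc k)))) (\<rho> (inv_into UNIV (ray D' \<alpha> k)) y)"
  by (simp add: inv_comp rep_comp ray_mem gen_mem inv_mem assms)

text \<open>The candidates for the fibre of the semi-conjugacy over \<open>x\<close>, as seen along the ray \<open>r\<close>.\<close>

definition fibre :: "(nat \<Rightarrow> 'a \<Rightarrow> 'a) \<Rightarrow> 'a \<Rightarrow> 'a set" where
  "fibre r x = {y. \<forall>k. dist (\<rho> (inv_into UNIV (r k)) y) (inv_into UNIV (r k) x) \<le> R}"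

text \<open>The step hypothesis of \<open>backward_contraction\<close> along a ray. It uses the code
  condition only at \<open>Suc k\<close>, hence never at time 0.\<close>

lemma ray_step:
  assumes "is_code D' \<eta> x \<alpha>"
    and "dist (\<rho> (inv_into UNIV (ray D' \<alpha> (Suc k))) y) (inv_into UNIV (ray D' \<alpha> (Suc k)) x) \<le> \<eta>"
  shows "dist (\<rho> (inv_into UNIV (ray D' \<alpha> k)) y) (inv_into UNIV (ray D' \<alpha> k) x)
    \<le> dist (\<rho> (inv_into UNIV (ray D' \<alpha> (Suc k))) y) (inv_into UNIV (ray D' \<alpha> (Suc k)) x) / lam D'
      + R * (1 - 1 / lam D')"
proof -
  let ?s = "gen D' (\<alpha> (Suc k))" and ?z = "orbit_pt D' \<alpha> x (Suc k)"
    and ?p = "\<rho> (inv_into UNIV (ray D' \<alpha> (Suc k))) y"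
  have i: "\<alpha> k \<in> index_set D'" for k using assms(1) by (simp add: is_code_def)
  have p: "\<rho> ?s ?p = \<rho> (inv_into UNIV (ray D' \<alpha> k)) y"
    by (simp only: rep_ray_Suc[OF i] rep_apply_inv[OF gen_mem[OF i]])
  have z: "inv_into UNIV (ray D' \<alpha> (Suc k)) x = inv_into UNIV ?s ?z"
    "inv_into UNIV (ray D' \<alpha> k) x = ?z"
    by (simp_all only: inv_ray[OF i] orbit_pt.simps(2)[of _ _ _ "Suc k"])
  have "ball ?z \<eta> \<subseteq> cov D' (\<alpha> (Suc k))" using assms(1) unfolding is_code_def by (metis le_add1 plus_1_eq_Suc)
  from rep_gen_contraction[OF i this, of ?p] assms(2) show ?thesis
    by (simp only: p z)
qed

text \<open>Backward contraction turns proximity of size \<open>\<eta> / 2\<close> at infinitely many times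
  into proximity of size \<open>R\<close> at all times.\<close>

lemma fibre_of_infinitely_often:
  assumes "is_code D' \<eta> x \<alpha>" and "infinite P"
    and "\<And>k. k \<in> P \<Longrightarrow> dist (\<rho> (inv_into UNIV (ray D' \<alpha> k)) y) (inv_into UNIV (ray D' \<alpha> k) x) \<le> \<eta> / 2"
  shows "y \<in> fibre (ray D' \<alpha>) x"
proof -
  define a where "a k = dist (\<rho> (inv_into UNIV (ray D' \<alpha> k)) y) (inv_into UNIV (ray D' \<alpha> k) x)" for k
  have "a i \<le> R" for i
  proof (rule field_le_epsilon)
    fix e :: real assume "0 < e"
    have "(\<lambda>n. (\<eta> / 2) / lam D' ^ n) \<longlonglongrightarrow> 0"
      using lam_gt by (intro LIMSEQ_divide_realpow_zero)
    then have "\<forall>\<^sub>F n in sequentially. (\<eta> / 2) / lam D' ^ n < e"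
      using \<open>0 < e\<close> order_tendstoD(2) by blast
    then obtain N where N: "\<And>n. n \<ge> N \<Longrightarrow> (\<eta> / 2) / lam D' ^ n < e"
      by (auto simp: eventually_sequentially)
    \<comment> \<open>Going back from such a \<open>k\<close> to \<open>i\<close> takes at least
      \<open>N\<close> steps, enough to shrink the initial excess \<open>\<eta> / 2\<close> below
      \<open>e\<close>.\<close>
    obtain k where k: "k \<in> P" "k \<ge> i + N" using assms(2) by (meson infinite_nat_iff_unbounded_le)
    have "a i \<le> R + (\<eta> / 2) / lam D' ^ (k - i)"
    proof (rule backward_contraction[where a = a and \<eta> = \<eta> and l = "lam D'"])
      show "a (i + (k - i)) \<le> R + \<eta> / 2"
        using assms(3)[OF k(1)] k(2) R_pos by (simp add: a_def)
    qed (use lam_gt eta_pos R_le ray_step[OF assms(1)] in \<open>auto simp: a_def\<close>)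
    also have "\<dots> \<le> R + e" using N[of "k - i"] k(2) by (simp add: less_imp_le)
    finally show "a i \<le> R + e" .
  qed
  then show ?thesis by (simp add: fibre_def a_def)
qed

section \<open>Independence of the fibre from the ray\<close>

lemma rep_change_ray:
  assumes "g \<in> \<Gamma>" and "h \<in> \<Gamma>"
  shows "\<rho> (inv_into UNIV g) y = \<rho> (inv_into UNIV g \<circ> h) (\<rho> (inv_into UNIV h) y)"
    and "inv_into UNIV g x = (inv_into UNIV g \<circ> h) (inv_into UNIV h x)"
  using assms by (simp_all add: rep_comp inv_mem rep_apply_inv apply_inv)

text \<open>At infinitely many times the two rays differ by a word \<open>w\<close> of length at
  most \<open>L\<close>. By \<open>near_words\<close>, closeness \<open>R\<close> along one ray
  becomes closeness \<open>\<eta> / 2\<close> along the other, and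
  \<open>fibre_of_infinitely_often\<close> restores \<open>R\<close>.\<close>

lemma L_close_fibre:
  assumes "L_close D' \<eta> x L r q"
  shows "fibre r x = fibre q x"
proof -
  obtain \<alpha> \<beta> where \<alpha>: "is_code D' \<eta> x \<alpha>" "r = ray D' \<alpha>" and \<beta>: "is_code D' \<eta> x \<beta>" "q = ray D' \<beta>"
    using assms by (auto simp: L_close_def Ray_def)
  obtain P Q where PQ: "infinite P" "infinite Q"
    "hausdorff_distance (word_dist (gens D')) (r ` P) (q ` Q) \<le> ereal L"
    using assms by (auto simp: L_close_def)
  have r: "r k \<in> \<Gamma>" and q: "q k \<in> \<Gamma>" for k
    using \<alpha> \<beta> by (auto simp: is_code_def intro: ray_mem)
  have "y \<in> fibre r x" if "y \<in> fibre q x" for y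
    unfolding \<alpha>(2)
  proof (rule fibre_of_infinitely_often[OF \<alpha>(1) PQ(1)], fold \<alpha>(2))
    fix k assume "k \<in> P"
    then obtain j where j: "word_dist (gens D') (r k) (q j) \<le> L"
      using hausdorff_distance_word_dist_le(1)[OF PQ(3)] by blast
    define w where "w = inv_into UNIV (r k) \<circ> q j"
    have "w \<in> \<Gamma>" unfolding w_def by (intro comp_mem inv_mem r q)
    moreover have "dist (\<rho> (inv_into UNIV (q j)) y) (inv_into UNIV (q j) x) \<le> R"
      using that by (simp add: fibre_def)
    moreover have "real (word_length (gens D') w) \<le> L" using j unfolding word_dist_def w_def .
    ultimately have "dist (\<rho> w (\<rho> (inv_into UNIV (q j)) y)) (w (inv_into UNIV (q j) x)) \<le> \<eta> / 2"
      by (meson near_words)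
    then show "dist (\<rho> (inv_into UNIV (r k)) y) (inv_into UNIV (r k) x) \<le> \<eta> / 2"
      using rep_change_ray[OF r[of k] q[of j]] unfolding w_def by metis
  qed
  \<comment> \<open>The reverse passage applies the inverse of \<open>w\<close>, covered by the
    second half of \<open>near_words\<close>.\<close>
  moreover have "y \<in> fibre q x" if "y \<in> fibre r x" for y
    unfolding \<beta>(2)
  proof (rule fibre_of_infinitely_often[OF \<beta>(1) PQ(2)], fold \<beta>(2))
    fix j assume "j \<in> Q"
    then obtain k where k: "word_dist (gens D') (r k) (q j) \<le> L"
      using hausdorff_distance_word_dist_le(2)[OF PQ(3)] by blast
    define w where "w = inv_into UNIV (r k) \<circ> q j"
    have "w \<in> \<Gamma>" unfolding w_def by (intro comp_mem inv_mem r q)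
    moreover have "dist (\<rho> (inv_into UNIV (r k)) y) (inv_into UNIV (r k) x) \<le> R"
      using that by (simp add: fibre_def)
    moreover have "real (word_length (gens D') w) \<le> L" using k unfolding word_dist_def w_def .
    ultimately have "dist (\<rho> (inv_into UNIV w) (\<rho> (inv_into UNIV (r k)) y))
        (inv_into UNIV w (inv_into UNIV (r k) x)) \<le> \<eta> / 2"
      by (meson near_words)
    moreover have "inv_into UNIV w = inv_into UNIV (q j) \<circ> r k"
      unfolding w_def by (simp only: r q inv_comp inv_mem inv_inv)
    ultimately show "dist (\<rho> (inv_into UNIV (q j)) y) (inv_into UNIV (q j) x) \<le> \<eta> / 2"
      using rep_change_ray[OF q[of j] r[of k]] by metis
  qed
  ultimately show ?thesis by blast
qed

text \<open>This is where meandering hyperbolicity enters: the fibre is constant along each chain of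
  \<open>L\<close>-close rays, whose members may be rays of \<open>D'\<close> only.\<close>

lemma fibre_independent:
  assumes "is_code D \<eta> x \<alpha>" and "is_code D \<eta> x \<beta>"
  shows "fibre (ray D \<alpha>) x = fibre (ray D \<beta>) x"
proof -
  have "equivclp (L_close D' \<eta> x L) (ray D \<alpha>) (ray D \<beta>)"
    using rays_equivalent[of "ray D \<alpha>" x "ray D \<beta>"] assms by (auto simp: L_equivalent_def Ray_def)
  then show ?thesis
    by (induction rule: equivclp_induct) (auto dest: L_close_fibre)
qed

section \<open>Initial codes and the action of a generator on fibres\<close>

definition chart :: "'a \<Rightarrow> nat" where
  "chart z = (SOME i. i \<in> index_set D \<and> ball z (del D) \<subseteq> cov D i)"

lemma chart: "chart z \<in> index_set D" "ball z (del D) \<subseteq> cov D (chart z)"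
proof -
  have "\<exists>i. i \<in> index_set D \<and> ball z (del D) \<subseteq> cov D i"
    using datum unfolding expanding_datum_def by metis
  from someI_ex[OF this] show "chart z \<in> index_set D" "ball z (del D) \<subseteq> cov D (chart z)"
    by (auto simp: chart_def)
qed

text \<open>Adds the condition at time 0 that codes lack, so that such a code can be prolonged
  backwards and controls \<open>x\<close> itself.\<close>

definition initial_code :: "'a \<Rightarrow> (nat \<Rightarrow> nat) \<Rightarrow> bool" where
  "initial_code x \<alpha> \<longleftrightarrow> is_code D \<eta> x \<alpha> \<and> ball x \<eta> \<subseteq> cov D (\<alpha> 0)"

lemma initial_code_exists: "\<exists>\<alpha>. initial_code x \<alpha>"
proof -
  \<comment> \<open>The orbit is built first, choosing a chart at each point; the code is then read
    off from it.\<close>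
  define z where "z = rec_nat x (\<lambda>_ w. inv_into UNIV (gen D (chart w)) w)"
  define \<alpha> where "\<alpha> = (\<lambda>k. chart (z k))"
  have "orbit_pt D \<alpha> x k = z k" for k by (induction k) (simp_all add: z_def \<alpha>_def)
  moreover have "ball (z k) \<eta> \<subseteq> cov D (\<alpha> k)" for k
    using chart(2)[of "z k"] eta eta_pos subset_ball[of \<eta> "del D" "z k"] by (simp add: \<alpha>_def)
  moreover have "z 0 = x" by (simp add: z_def)
  ultimately show ?thesis
    using chart(1) unfolding initial_code_def is_code_def \<alpha>_def by metis
qed

text \<open>The fibre gives closeness only after the first generator has been undone; the condition
  at time 0 permits one more backward contraction.\<close>

lemma initial_code_dist:
  assumes "initial_code x \<alpha>" and "y \<in> fibre (ray D \<alpha>) x"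
  shows "dist y x \<le> R"
proof -
  have code: "is_code D \<eta> x \<alpha>" and ball: "ball x \<eta> \<subseteq> cov D (\<alpha> 0)" using assms by (auto simp: initial_code_def)
  have i: "\<alpha> 0 \<in> index_set D" "\<alpha> 0 \<in> index_set D'"
    using code is_code_refine(1)[OF code] by (auto simp: is_code_def)
  let ?s = "gen D' (\<alpha> 0)"
  have d: "dist (\<rho> (inv_into UNIV ?s) y) (inv_into UNIV ?s x) \<le> R"
    using assms(2) gen_refine[OF i(1)] unfolding fibre_def by (metis (mono_tags, lifting) mem_Collect_eq ray.simps(1))
  then have "dist (\<rho> ?s (\<rho> (inv_into UNIV ?s) y)) x
      \<le> dist (\<rho> (inv_into UNIV ?s) y) (inv_into UNIV ?s x) / lam D' + R * (1 - 1 / lam D')"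
    using ball cov_refine[OF i(1)] R_le eta_pos by (intro rep_gen_contraction i) auto
  also have "\<dots> \<le> R / lam D' + R * (1 - 1 / lam D')"
    using d lam_gt by (simp add: divide_right_mono)
  also have "\<dots> = R" by (simp add: algebra_simps)
  finally show ?thesis using i by (simp add: rep_apply_inv gen_mem)
qed

text \<open>No condition is imposed on a code at time \<open>0\<close>, so prepending \<open>i\<close> to a code for \<open>x\<close>
  gives a code for \<open>s\<^sub>i x\<close>.\<close>

lemma fibre_gen:
  assumes "is_code D \<eta> x \<alpha>" and "y \<in> fibre (ray D \<alpha>) x" and "i \<in> index_set D"
  shows "\<exists>\<beta>. is_code D \<eta> (gen D i x) \<beta> \<and> \<rho> (gen D i) y \<in> fibre (ray D \<beta>) (gen D i x)"
proof -
  \<comment> \<open>The given code may fail the condition at time 0, which becomes time 1 after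
    prepending. By \<open>fibre_independent\<close> it can be replaced by an initial code.\<close>
  obtain \<gamma> where \<gamma>: "initial_code x \<gamma>" using initial_code_exists by blast
  have y: "y \<in> fibre (ray D \<gamma>) x"
    using fibre_independent[of x \<alpha> \<gamma>] assms \<gamma> by (simp add: initial_code_def)
  have code: "is_code D \<eta> x \<gamma>" using \<gamma> by (simp add: initial_code_def)
  have s: "gen D i \<in> \<Gamma>" using assms(3) by (simp add: gen_refine gen_mem index_refine)
  let ?\<beta> = "case_nat i \<gamma>"
  have orb: "orbit_pt D ?\<beta> (gen D i x) (Suc k) = orbit_pt D \<gamma> x k" for k
    by (induction k) (simp_all add: inv_apply s)
  have "is_code D \<eta> (gen D i x) ?\<beta>"
    unfolding is_code_def
  proof (intro conjI allI impI)
    fix k show "?\<beta> k \<in> index_set D" using assms(3) code by (cases k) (auto simp: is_code_def)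
  next
    fix k :: nat assume "1 \<le> k"
    then obtain j where k: "k = Suc j" by (cases k) auto
    \<comment> \<open>For \<open>j = 0\<close> this is the extra clause of
      \<open>initial_code\<close>.\<close>
    have "ball (orbit_pt D \<gamma> x j) \<eta> \<subseteq> cov D (\<gamma> j)"
      using \<gamma> unfolding initial_code_def is_code_def by (cases j) (metis orbit_pt.simps(1), metis le_add1 plus_1_eq_Suc)
    then show "ball (orbit_pt D ?\<beta> (gen D i x) k) \<eta> \<subseteq> cov D (?\<beta> k)"
      unfolding k orb by simp
  qed
  moreover have "\<rho> (gen D i) y \<in> fibre (ray D ?\<beta>) (gen D i x)"
    unfolding fibre_def mem_Collect_eq
  proof
    fix k
    have rSuc: "ray D ?\<beta> (Suc j) = gen D i \<circ> ray D \<gamma> j" for j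
      by (induction j) (simp_all only: ray.simps nat.case comp_assoc[symmetric])
    show "dist (\<rho> (inv_into UNIV (ray D ?\<beta> k)) (\<rho> (gen D i) y)) (inv_into UNIV (ray D ?\<beta> k) (gen D i x)) \<le> R"
    proof (cases k)
      \<comment> \<open>At time 0 the generator cancels, leaving
        \<open>dist y x \<le> R\<close>.\<close>
      case 0
      then show ?thesis using initial_code_dist[OF \<gamma> y] by (simp add: rep_inv_apply inv_apply s)
    next
      case (Suc j)
      have "ray D \<gamma> j \<in> \<Gamma>"
        using ray_mem[of \<gamma> j] is_code_refine[OF code] by (simp add: is_code_def)
      then show ?thesis
        using y unfolding Suc rSuc fibre_def
        by (simp add: inv_comp s rep_comp inv_mem rep_inv_apply inv_apply)
    qed
  qed
  ultimately show ?thesis by blast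
qed

section \<open>The equivariant relation formed by the fibres\<close>

definition coded :: "'a \<Rightarrow> 'a \<Rightarrow> bool" where
  "coded x y \<longleftrightarrow> (\<exists>\<alpha>. is_code D \<eta> x \<alpha> \<and> y \<in> fibre (ray D \<alpha>) x)"

text \<open>By \<open>fibre_independent\<close>, the witnessing code may be taken to be
  initial.\<close>

lemma coded_dist:
  assumes "coded x y" shows "dist y x \<le> R"
proof -
  obtain \<gamma> where \<gamma>: "initial_code x \<gamma>" using initial_code_exists by blast
  then show ?thesis
    using assms fibre_independent initial_code_dist unfolding coded_def initial_code_def by blast
qed

lemma coded_equivariant:
  assumes "g \<in> \<Gamma>" and "coded x y"
  shows "coded (g x) (\<rho> g y)"
proof -
  have sub: "gens D \<subseteq> \<Gamma>" and sym: "inv_into UNIV ` gens D = gens D"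
    and gen: "generate homeo_group (gens D) = \<Gamma>"
    using datum by (auto simp: expanding_datum_def)
  \<comment> \<open>Since \<open>gens D\<close> is symmetric, words without inverse letters
    suffice.\<close>
  obtain ws where ws: "set ws \<subseteq> gens D" "g = foldr (\<circ>) ws id"
    using word_of_generated[OF sub, of g] assms(1) sym gen by auto
  from ws(1) have "coded (foldr (\<circ>) ws id x) (\<rho> (foldr (\<circ>) ws id) y)"
  proof (induction ws)
    case Nil
    have "foldr (\<circ>) [] id = (id :: 'a \<Rightarrow> 'a)" by (simp only: foldr.simps id_apply[of id])
    then show ?case using assms(2) rep_id by (metis id_apply)
  next
    case (Cons s ws)
    have mem: "s \<in> \<Gamma>" "foldr (\<circ>) ws id \<in> \<Gamma>" using Cons.prems sub by (auto intro: foldr_comp_mem)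
    obtain i where "i \<in> index_set D" "s = gen D i" using Cons.prems by (auto simp: gens_def)
    moreover have "set ws \<subseteq> gens D" using Cons.prems by simp
    then have "coded (foldr (\<circ>) ws id x) (\<rho> (foldr (\<circ>) ws id) y)" by (rule Cons.IH)
    ultimately have "coded (s (foldr (\<circ>) ws id x)) (\<rho> s (\<rho> (foldr (\<circ>) ws id) y))"
      unfolding coded_def using fibre_gen by blast
    moreover have "foldr (\<circ>) (s # ws) id = s \<circ> foldr (\<circ>) ws id" by (simp only: foldr.simps comp_apply[of _ _ id])
    ultimately show ?case using rep_comp[OF mem] by (metis comp_apply)
  qed
  then show ?thesis using ws(2) by simp
qed

text \<open>Matching the orbit of \<open>x\<close> exactly at time \<open>n\<close> gives closeness
  \<open>R\<close> at all earlier times; a limit point as \<open>n\<close> grows lies in the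
  fibre.\<close>

lemma coded_right_total: "\<exists>y. coded x y"
proof -
  obtain \<alpha> where code: "is_code D \<eta> x \<alpha>" using initial_code_exists by (auto simp: initial_code_def)
  note code' = is_code_refine[OF code]
  have i: "\<alpha> k \<in> index_set D'" for k using code'(1) by (simp add: is_code_def)
  define f where "f n = \<rho> (ray D' \<alpha> n) (inv_into UNIV (ray D' \<alpha> n) x)" for n
  have f: "dist (\<rho> (inv_into UNIV (ray D' \<alpha> k)) (f n)) (inv_into UNIV (ray D' \<alpha> k) x) \<le> R"
    if "k \<le> n" for k n
  proof -
    define a where "a k = dist (\<rho> (inv_into UNIV (ray D' \<alpha> k)) (f n)) (inv_into UNIV (ray D' \<alpha> k) x)" for k
    have "a k \<le> R + 0 / lam D' ^ (n - k)"
    \<comment> \<open>Exact agreement at time \<open>n\<close> allows excess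
      \<open>c = 0\<close>.\<close>
    proof (rule backward_contraction[where a = a and \<eta> = \<eta> and l = "lam D'"])
      show "a (k + (n - k)) \<le> R + 0"
        using that R_pos by (simp add: a_def f_def rep_inv_apply ray_mem i)
    qed (use lam_gt eta_pos R_le ray_step[OF code'(1)] in \<open>auto simp: a_def\<close>)
    then show ?thesis by (simp add: a_def)
  qed
  obtain y u where u: "strict_mono u" "(f \<circ> u) \<longlonglongrightarrow> y"
    using compact unfolding compact_def by (metis UNIV_I)
  have "dist (\<rho> (inv_into UNIV (ray D' \<alpha> k)) y) (inv_into UNIV (ray D' \<alpha> k) x) \<le> R" for k
  proof (rule LIMSEQ_le_const2)
    have "continuous_on UNIV (\<rho> (inv_into UNIV (ray D' \<alpha> k)))"
      by (simp add: rep_cont inv_mem ray_mem i)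
    then have "(\<lambda>n. \<rho> (inv_into UNIV (ray D' \<alpha> k)) ((f \<circ> u) n)) \<longlonglongrightarrow> \<rho> (inv_into UNIV (ray D' \<alpha> k)) y"
      using u(2) by (rule continuous_on_tendsto_compose) simp_all
    then show "(\<lambda>n. dist (\<rho> (inv_into UNIV (ray D' \<alpha> k)) ((f \<circ> u) n)) (inv_into UNIV (ray D' \<alpha> k) x))
        \<longlonglongrightarrow> dist (\<rho> (inv_into UNIV (ray D' \<alpha> k)) y) (inv_into UNIV (ray D' \<alpha> k) x)"
      by (intro tendsto_dist tendsto_const)
    have "k \<le> u n" if "n \<ge> k" for n using seq_suble[OF u(1), of n] that by linarith
    then show "\<exists>N. \<forall>n\<ge>N. dist (\<rho> (inv_into UNIV (ray D' \<alpha> k)) ((f \<circ> u) n)) (inv_into UNIV (ray D' \<alpha> k) x) \<le> R"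
      using f by auto
  qed
  then have "y \<in> fibre (ray D \<alpha>) x" by (simp add: fibre_def code'(2))
  then show ?thesis using code unfolding coded_def by blast
qed

text \<open>An orbit of \<open>\<rho>\<close> is a pseudo-orbit of \<open>\<Gamma>\<close>, hence shadowed by a genuine orbit.\<close>

lemma coded_left_total: "\<exists>x. coded x y"
proof -
  \<comment> \<open>The \<rho>-orbit of \<open>y\<close>, with charts chosen along it rather than
    along an orbit of the original action.\<close>
  define z where "z = rec_nat y (\<lambda>_ w. \<rho> (inv_into UNIV (gen D (chart w))) w)"
  define \<alpha> where "\<alpha> = (\<lambda>k. chart (z k))"
  have iD: "\<alpha> k \<in> index_set D" for k by (simp add: \<alpha>_def chart)
  then have i: "\<alpha> k \<in> index_set D'" for k by (simp add: index_refine)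
  have g: "gen D (\<alpha> k) = gen D' (\<alpha> k)" for k by (simp add: gen_refine iD)
  have z: "z 0 = y" "z (Suc k) = \<rho> (inv_into UNIV (gen D' (\<alpha> k))) (z k)" for k
    using g[of k] by (simp_all add: z_def \<alpha>_def)
  have zray: "z (Suc k) = \<rho> (inv_into UNIV (ray D' \<alpha> k)) y" for k
    by (induction k) (simp_all only: z ray.simps(1) rep_ray_Suc[OF i])
  have ray_eq: "ray D \<alpha> k = ray D' \<alpha> k" for k by (induction k) (simp_all add: g)
  have orb_eq: "orbit_pt D \<alpha> p k = orbit_pt D' \<alpha> p k" for p k by (induction k) (simp_all add: g)
  have orb_cont: "continuous_on UNIV (\<lambda>p. orbit_pt D' \<alpha> p k)" for k
  proof (cases k)
    case (Suc j)
    have "continuous_on UNIV (inv_into UNIV (ray D' \<alpha> j))" by (simp add: cont inv_mem ray_mem i)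
    then show ?thesis unfolding Suc inv_ray[OF i, symmetric] by simp
  qed simp
  \<comment> \<open>The point whose orbit under the original action meets \<open>z\<close> exactly
    at time \<open>Suc n\<close>.\<close>
  define f where "f n = ray D' \<alpha> n (z (Suc n))" for n
  have f: "dist (orbit_pt D' \<alpha> (f n) k) (z k) \<le> R" if "k \<le> Suc n" for k n
    using that
  proof (induction rule: inc_induct)
    case base
    show ?case using R_pos by (simp only: inv_ray[OF i, symmetric] f_def inv_apply[OF ray_mem[OF i]] dist_self less_imp_le)
  next
    case (step k)
    let ?s = "gen D' (\<alpha> k)" and ?p = "orbit_pt D' \<alpha> (f n) (Suc k)"
    have p: "?s ?p = orbit_pt D' \<alpha> (f n) k" by (simp add: apply_inv gen_mem i)
    \<comment> \<open>The jump of the pseudo-orbit occurs before the contraction, so it is divided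
      by \<open>lam D'\<close> as well. Contraction is now centred at \<open>z k\<close>.\<close>
    have "dist (z (Suc k)) (inv_into UNIV ?s (z k)) \<le> R * (1 - 1 / lam D')"
      unfolding z by (intro near_gens inv_gen_mem i)
    then have d: "dist ?p (inv_into UNIV ?s (z k)) \<le> R + R * (1 - 1 / lam D')"
      using step.IH dist_triangle[of ?p "inv_into UNIV ?s (z k)" "z (Suc k)"] by linarith
    have *: "R * (1 - 1 / lam D') \<le> R" using R_pos lam_gt by (simp add: mult_left_le)
    have "ball (z k) \<eta> \<subseteq> cov D' (\<alpha> k)"
      using chart(2)[of "z k"] cov_refine[OF iD[of k]] eta eta_pos subset_ball[of \<eta> "del D" "z k"]
      unfolding \<alpha>_def by auto
    then have "dist (?s ?p) (z k) \<le> dist ?p (inv_into UNIV ?s (z k)) / lam D'"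
      using d * R_le by (intro gen_contraction i) auto
    also have "\<dots> \<le> (R + R * (1 - 1 / lam D')) / lam D'"
      using d lam_gt by (simp add: divide_right_mono)
    also have "\<dots> \<le> R"
    proof -
      \<comment> \<open>Equivalent to \<open>(lam D' - 1)\<^sup>2 / lam D'\<close> being
        nonnegative.\<close>
      have "R * (1 - 1 / lam D') \<le> R * (lam D' - 1)"
      proof (rule mult_left_mono)
        have "0 \<le> (lam D' - 1)\<^sup>2 / lam D'" using lam_gt by simp
        also have "\<dots> = (lam D' - 1) - (1 - 1 / lam D')"
          using lam_gt by (simp add: field_simps power2_eq_square)
        finally show "1 - 1 / lam D' \<le> lam D' - 1" by simp
      qed (use R_pos in simp)
      then show ?thesis using lam_gt by (simp add: divide_le_eq algebra_simps)
    qed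
    finally show ?case unfolding p .
  qed
  obtain x u where u: "strict_mono u" "(f \<circ> u) \<longlonglongrightarrow> x"
    using compact unfolding compact_def by (metis UNIV_I)
  have near: "dist (orbit_pt D' \<alpha> x k) (z k) \<le> R" for k
  proof (rule LIMSEQ_le_const2)
    have "(\<lambda>n. orbit_pt D' \<alpha> ((f \<circ> u) n) k) \<longlonglongrightarrow> orbit_pt D' \<alpha> x k"
      using continuous_on_tendsto_compose[OF orb_cont u(2)] by simp
    then show "(\<lambda>n. dist (orbit_pt D' \<alpha> ((f \<circ> u) n) k) (z k)) \<longlonglongrightarrow> dist (orbit_pt D' \<alpha> x k) (z k)"
      by (intro tendsto_dist tendsto_const)
    have "k \<le> Suc (u n)" if "n \<ge> k" for n using seq_suble[OF u(1), of n] that by linarith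
    then show "\<exists>N. \<forall>n\<ge>N. dist (orbit_pt D' \<alpha> ((f \<circ> u) n) k) (z k) \<le> R"
      using f by auto
  qed
  have "is_code D \<eta> x \<alpha>"
    unfolding is_code_def
  proof (intro conjI allI impI iD)
    fix k
    \<comment> \<open>Here \<open>R + \<eta> \<le> 2 * \<eta> = del D\<close>.\<close>
    have "ball (orbit_pt D \<alpha> x k) \<eta> \<subseteq> ball (z k) (del D)"
    proof
      fix p assume "p \<in> ball (orbit_pt D \<alpha> x k) \<eta>"
      then show "p \<in> ball (z k) (del D)"
        using near[of k] dist_triangle[of "z k" p "orbit_pt D' \<alpha> x k"] eta R_le eta_pos
        by (simp add: orb_eq dist_commute)
    qed
    then show "ball (orbit_pt D \<alpha> x k) \<eta> \<subseteq> cov D (\<alpha> k)"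
      using chart(2)[of "z k"] unfolding \<alpha>_def by blast
  qed
  moreover have "y \<in> fibre (ray D \<alpha>) x"
    using near by (simp only: fibre_def ray_eq mem_Collect_eq inv_ray[OF i] zray[symmetric] dist_commute) simp
  ultimately show ?thesis unfolding coded_def by blast
qed

section \<open>Expansivity and construction of the semi-conjugacy\<close>

text \<open>Along an initial code of \<open>x\<close> the unperturbed generators contract without
  error, so a distance that stays below \<open>\<eta>\<close> is at most
  \<open>\<eta> / lam D' ^ n\<close> at time 0, for every \<open>n\<close>.\<close>

lemma expansive:
  assumes "\<And>g. g \<in> \<Gamma> \<Longrightarrow> dist (g x) (g x') \<le> \<eta>"
  shows "x = x'"
proof -
  obtain \<alpha> where \<alpha>: "initial_code x \<alpha>" using initial_code_exists by blast
  then have code: "is_code D \<eta> x \<alpha>" by (simp add: initial_code_def)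
  note code' = is_code_refine[OF code]
  have iD: "\<alpha> k \<in> index_set D" for k using code by (simp add: is_code_def)
  have i: "\<alpha> k \<in> index_set D'" for k using code' by (simp add: is_code_def)
  define a where "a k = dist (orbit_pt D' \<alpha> x' k) (orbit_pt D' \<alpha> x k)" for k
  have a_le: "a k \<le> \<eta>" for k
  proof (cases k)
    case 0
    then show ?thesis using assms[OF id_mem] by (simp add: a_def dist_commute)
  next
    case (Suc j)
    have "dist (inv_into UNIV (ray D' \<alpha> j) x) (inv_into UNIV (ray D' \<alpha> j) x') \<le> \<eta>"
      by (intro assms inv_mem ray_mem i)
    then show ?thesis unfolding Suc a_def inv_ray[OF i] by (subst dist_commute)
  qed
  have step: "a k \<le> a (Suc k) / lam D'" for k
  proof -
    have "ball (orbit_pt D \<alpha> x k) \<eta> \<subseteq> cov D (\<alpha> k)"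
      using \<alpha> unfolding initial_code_def is_code_def by (cases k) (metis orbit_pt.simps(1), metis le_add1 plus_1_eq_Suc)
    then have "ball (orbit_pt D' \<alpha> x k) \<eta> \<subseteq> cov D' (\<alpha> k)"
      using cov_refine[OF iD[of k]] by (auto simp: code'(3))
    from gen_contraction[OF i this, of "orbit_pt D' \<alpha> x' (Suc k)"] show ?thesis
      using a_le[of "Suc k"] by (simp add: a_def apply_inv gen_mem i)
  qed
  have "a 0 \<le> a n / lam D' ^ n" for n
  proof (induction n)
    case (Suc n)
    also have "a n / lam D' ^ n \<le> (a (Suc n) / lam D') / lam D' ^ n"
      using step[of n] lam_gt by (intro divide_right_mono) auto
    finally show ?case by simp
  qed simp
  moreover have "a n / lam D' ^ n \<le> \<eta> / lam D' ^ n" for n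
    using a_le lam_gt by (simp add: divide_right_mono)
  ultimately have "a 0 \<le> \<eta> / lam D' ^ n" for n by (rule order_trans)
  moreover have "(\<lambda>n. \<eta> / lam D' ^ n) \<longlonglongrightarrow> 0"
    using lam_gt by (intro LIMSEQ_divide_realpow_zero)
  ultimately have "a 0 \<le> 0" by (meson LIMSEQ_le_const)
  then show ?thesis by (simp add: a_def)
qed

text \<open>The relation \<open>near\<close> contains \<open>coded\<close>, hence is total on both
  sides, but unlike \<open>coded\<close> it is visibly closed and single-valued.\<close>

lemma semi_conjugate_inclusion: "semi_conjugate \<Gamma> \<rho> (inclusion_hom \<Gamma>)"
proof -
  define near where "near y x \<longleftrightarrow> (\<forall>g\<in>\<Gamma>. dist (\<rho> g y) (g x) \<le> R)" for y x
  \<comment> \<open>Equivariance upgrades the bound on \<open>dist y x\<close> to one for every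
    group element.\<close>
  have coded_near: "near y x" if "coded x y" for x y
    unfolding near_def using coded_dist[OF coded_equivariant[OF _ that]] by blast
  have unique: "x = x'" if "near y x" "near y x'" for y x x'
  proof (rule expansive)
    fix g assume "g \<in> \<Gamma>"
    then have "dist (\<rho> g y) (g x) \<le> R" "dist (\<rho> g y) (g x') \<le> R" using that by (auto simp: near_def)
    then show "dist (g x) (g x') \<le> \<eta>"
      using dist_triangle3[of "g x" "g x'" "\<rho> g y"] R_le by linarith
  qed
  define \<phi> where "\<phi> y = (THE x. near y x)" for y
  have near_phi: "near y x \<longleftrightarrow> x = \<phi> y" for y x
  proof -
    obtain x' where x': "near y x'" using coded_left_total coded_near by blast
    then have "\<phi> y = x'" unfolding \<phi>_def using unique by blast
    then show ?thesis using x' unique by blast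
  qed
  have "continuous_on UNIV \<phi>"
  proof (rule continuous_on_closed_graph[OF compact compact])
    have "closed (\<Inter>g\<in>\<Gamma>. {p. dist (\<rho> g (fst p)) (g (snd p)) \<le> R})"
    proof (intro closed_INT ballI closed_Collect_le continuous_on_dist continuous_on_const)
      fix g assume "g \<in> \<Gamma>"
      then show "continuous_on UNIV (\<lambda>p. \<rho> g (fst p))" "continuous_on UNIV (\<lambda>p. g (snd p))"
        using continuous_on_compose2[OF rep_cont continuous_on_fst[OF continuous_on_id] subset_UNIV]
          continuous_on_compose2[OF cont continuous_on_snd[OF continuous_on_id] subset_UNIV] by blast+
    qed
    also have "(\<Inter>g\<in>\<Gamma>. {p. dist (\<rho> g (fst p)) (g (snd p)) \<le> R}) = {(y, x). x = \<phi> y}"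
      unfolding near_phi[symmetric] near_def by auto
    finally show "closed {(y, x). x = \<phi> y}" .
  qed
  moreover have "surj \<phi>"
    unfolding surj_def using coded_right_total coded_near near_phi by blast
  \<comment> \<open>Right translation by \<open>h\<close> preserves \<Gamma>, so \<open>near\<close>
    is invariant, and uniqueness identifies the image.\<close>
  moreover have "\<phi> \<circ> \<rho> h = inclusion_hom \<Gamma> h \<circ> \<phi>" if "h \<in> \<Gamma>" for h
  proof
    fix y
    have "near y (\<phi> y)" by (simp add: near_phi)
    then have "dist (\<rho> (g \<circ> h) y) ((g \<circ> h) (\<phi> y)) \<le> R" if "g \<in> \<Gamma>" for g
      using comp_mem[OF that \<open>h \<in> \<Gamma>\<close>] by (auto simp: near_def)
    then have "near (\<rho> h y) (h (\<phi> y))" using that by (simp add: near_def rep_comp)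
    then show "(\<phi> \<circ> \<rho> h) y = (inclusion_hom \<Gamma> h \<circ> \<phi>) y"
      using that by (simp add: near_phi inclusion_hom_def)
  qed
  ultimately show ?thesis unfolding semi_conjugate_def by blast
qed

end

section \<open>Choice of constants and of the neighborhood\<close>

lemma exists_modulus:
  fixes W :: "('a::metric_space \<Rightarrow> 'a) set"
  assumes "compact (UNIV :: 'a set)" and "finite W" and "\<And>w. w \<in> W \<Longrightarrow> continuous_on UNIV w" and "0 < \<epsilon>"
  shows "\<exists>d>0. \<forall>w\<in>W. \<forall>p q. dist p q < d \<longrightarrow> dist (w p) (w q) < \<epsilon>"
  using assms(2,3)
proof (induction rule: finite_induct)
  case empty
  show ?case by (auto intro: exI[of _ 1])
next
  case (insert w W)
  obtain d where d: "d > 0" "\<forall>w\<in>W. \<forall>p q. dist p q < d \<longrightarrow> dist (w p) (w q) < \<epsilon>"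
    using insert by auto
  have "uniformly_continuous_on UNIV w"
    using compact_uniformly_continuous[OF _ assms(1)] insert.prems by blast
  then obtain d' where "d' > 0" "\<forall>p q. dist p q < d' \<longrightarrow> dist (w p) (w q) < \<epsilon>"
    unfolding uniformly_continuous_on_def using assms(4) by (metis UNIV_I dist_commute)
  then show ?case using d by (intro exI[of _ "min d d'"]) auto
qed

lemma rep_near_on_finite:
  fixes \<Gamma> A :: "('a::metric_space \<Rightarrow> 'a) set"
  assumes "compact (UNIV :: 'a set)" and "homeo_subgroup \<Gamma>"
    and "A \<subseteq> \<Gamma>" and "generate homeo_group A = \<Gamma>" and "finite W" and "W \<subseteq> \<Gamma>" and "0 < \<epsilon>"
  shows "\<exists>e>0. \<forall>\<rho>\<in>Hom_homeo \<Gamma>. (\<forall>a\<in>A. C0_dist (\<rho> a) a < e) \<longrightarrow>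
           (\<forall>g\<in>W. \<forall>x. dist (\<rho> g x) (g x) \<le> \<epsilon>)"
  using assms(5,6)
proof (induction rule: finite_induct)
  case empty
  show ?case by (auto intro: exI[of _ 1])
next
  case (insert g W)
  obtain e where e: "e > 0" "\<forall>\<rho>\<in>Hom_homeo \<Gamma>. (\<forall>a\<in>A. C0_dist (\<rho> a) a < e) \<longrightarrow>
      (\<forall>g\<in>W. \<forall>x. dist (\<rho> g x) (g x) \<le> \<epsilon>)"
    using insert by auto
  obtain e' where e': "e' > 0" "\<forall>\<rho>\<in>Hom_homeo \<Gamma>. (\<forall>a\<in>A. C0_dist (\<rho> a) a < e') \<longrightarrow>
      (\<forall>x. dist (\<rho> g x) (g x) \<le> \<epsilon>)"
    using rep_near_on_generated[OF assms(1-4) _ assms(7), of g] insert.prems by auto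
  show ?case using e e' by (intro exI[of _ "min e e'"]) auto
qed

theorem theorem1p1:
  fixes \<Gamma> A :: "('a::metric_space \<Rightarrow> 'a) set"
  assumes "compact (UNIV :: 'a set)"
    and "subgroup \<Gamma> homeo_group"
    and "finite A" and "A \<subseteq> \<Gamma>" and "generate homeo_group A = \<Gamma>"
    and "meandering_hyperbolic \<Gamma>"
  shows "\<exists>V. openin (Hom_topology \<Gamma> A) V \<and> inclusion_hom \<Gamma> \<in> V \<and>
           (\<forall>\<rho>\<in>V. semi_conjugate \<Gamma> \<rho> (inclusion_hom \<Gamma>))"
proof -
  interpret homeo_subgroup \<Gamma> by (rule homeo_subgroup.intro) fact
  obtain D D' L where D: "expanding_datum \<Gamma> D" and D': "expanding_datum \<Gamma> D'" and ref: "D \<prec>\<^sub>D D'"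
    and equiv: "\<And>x \<eta> r q. 0 < \<eta> \<Longrightarrow> \<eta> \<le> del D \<Longrightarrow> r \<in> Ray D \<eta> x \<Longrightarrow> q \<in> Ray D \<eta> x \<Longrightarrow>
      L_equivalent D' \<eta> x L r q"
    using assms(6) unfolding meandering_hyperbolic_def by metis
  define \<eta> where "\<eta> = del D / 2"
  have \<eta>: "0 < \<eta>" "\<eta> \<le> del D" and lam: "lam D' > 1"
    using D D' by (auto simp: \<eta>_def expanding_datum_def)
  have gens: "finite (gens D')" "gens D' \<subseteq> \<Gamma>" "generate homeo_group (gens D') = \<Gamma>"
    using D' by (auto simp: expanding_datum_def gens_def index_set_def)
  \<comment> \<open>All words that can relate \<open>L\<close>-close rays; \<open>W\<close> adjoins
    their inverses.\<close>
  define W0 where "W0 = {g \<in> \<Gamma>. real (word_length (gens D') g) \<le> L}"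
  define W where "W = W0 \<union> inv_into UNIV ` W0"
  have W: "finite W" "W \<subseteq> \<Gamma>"
    using finite_word_length_le[OF gens, of L] by (auto simp: W_def W0_def inv_mem)
  have "\<exists>d>0. \<forall>w\<in>W. \<forall>p q. dist p q < d \<longrightarrow> dist (w p) (w q) < \<eta> / 4"
    using cont W(2) \<eta>(1) by (intro exists_modulus assms(1) W(1)) auto
  then obtain d where d: "d > 0" "\<And>w p q. w \<in> W \<Longrightarrow> dist p q < d \<Longrightarrow> dist (w p) (w q) < \<eta> / 4"
    by blast
  \<comment> \<open>Below the modulus \<open>d\<close>, so words of \<open>W\<close> spread points
    by less than \<open>\<eta> / 4\<close>; the other \<open>\<eta> / 4\<close> is left for the
    error of \<rho>.\<close>
  define R where "R = min (d / 2) (\<eta> / 4)"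
  have R: "0 < R" "R \<le> \<eta> / 4" "R < d" using d(1) \<eta> by (auto simp: R_def)
  \<comment> \<open>The error that leaves \<open>R\<close> fixed under one backward step.\<close>
  define \<epsilon> where "\<epsilon> = R * (1 - 1 / lam D')"
  have \<epsilon>: "0 < \<epsilon>" "\<epsilon> \<le> R" using R(1) lam by (simp_all add: \<epsilon>_def mult_left_le)
  obtain e where e: "e > 0" "\<And>\<rho> g x. \<rho> \<in> Hom_homeo \<Gamma> \<Longrightarrow> \<forall>a\<in>A. C0_dist (\<rho> a) a < e \<Longrightarrow>
      g \<in> W \<union> gens D' \<Longrightarrow> dist (\<rho> g x) (g x) \<le> \<epsilon>"
    using rep_near_on_finite[OF assms(1) homeo_subgroup_axioms assms(4,5), of "W \<union> gens D'" \<epsilon>]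
      W gens \<epsilon>(1) by blast
  let ?V = "{\<rho> \<in> Hom_homeo \<Gamma>. \<forall>a\<in>A. C0_dist (\<rho> a) a < e}"
  have "openin (Hom_topology \<Gamma> A) ?V"
    using mem_homeo by (intro openin_C0_neighborhood assms) auto
  moreover have "inclusion_hom \<Gamma> \<in> ?V"
    using inclusion_hom_mem[OF assms(2)] assms(4) e(1)
    by (auto simp: inclusion_hom_def subset_iff C0_dist_def)
  moreover have "semi_conjugate \<Gamma> \<rho> (inclusion_hom \<Gamma>)" if "\<rho> \<in> ?V" for \<rho>
  proof -
    have W_near: "dist (\<rho> w p) (w q) \<le> \<eta> / 2" if "w \<in> W" "dist p q \<le> R" for w p q
    proof -
      have "dist (w p) (w q) < \<eta> / 4" using d(2)[OF that(1)] that(2) R(3) by simp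
      moreover have "dist (\<rho> w p) (w p) \<le> \<eta> / 4"
        using e(2)[of \<rho> w p] \<open>\<rho> \<in> ?V\<close> that(1) \<epsilon>(2) R(2) by force
      ultimately show ?thesis using dist_triangle[of "\<rho> w p" "w q" "w p"] by linarith
    qed
    interpret meandering_perturbation \<Gamma> \<rho> D D' L \<eta> R
    proof unfold_locales
      show "\<rho> \<in> Hom_homeo \<Gamma>" using that by simp
      show "L_equivalent D' \<eta> x L r q" if "r \<in> Ray D \<eta> x" "q \<in> Ray D \<eta> x" for x r q
        using equiv[OF \<eta> that] .
      show "dist (\<rho> w p) (w q) \<le> \<eta> / 2 \<and> dist (\<rho> (inv_into UNIV w) p) (inv_into UNIV w q) \<le> \<eta> / 2"
        if "w \<in> \<Gamma>" "real (word_length (gens D') w) \<le> L" "dist p q \<le> R" for w p q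
        using that by (intro conjI W_near) (auto simp: W_def W0_def)
      show "dist (\<rho> s x) (s x) \<le> R * (1 - 1 / lam D')" if "s \<in> gens D'" for s x
        using e(2)[of \<rho> s x] \<open>\<rho> \<in> ?V\<close> that by (simp add: \<epsilon>_def)
    qed (use assms(1) D D' ref R \<eta> in \<open>auto simp: \<eta>_def\<close>)
    show ?thesis by (rule semi_conjugate_inclusion)
  qed
  ultimately show ?thesis by blast
qed

end
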